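(* Let $d\ge 1$, let $S=\{s_0,\dots,s_{n_S-1}\}$ be a non-empty finite set of rational points in $[0,1)^d$, and let $P\subset\mathbf{R}^d$ be a full-dimensional polytope defined by rational linear inequalities. Let $Q$, $H$, $n_H$, $d_H$, $\lambda_H$, and for each positive integer $m$ the graphs $E_m$ and $G_m$, be as described in the context below. Assume that $\lambda_H+2n_H^{-1/2}<0.99$ and that $\lambda_{E_m}\le 2n_H^{-1/2}+\delta_m$ with $\delta_m\to 0$ as $m\to\infty$. Then there is a constant $c<1$, independent of $m$, such that for all sufficiently large $m$ the absolute value of the second largest eigenvalue of the normalized adjacency matrix of $G_m$ is at most $c$. In other words, the random walk on $G_m$ (from which the vertices not corresponding to points of $(S+\mathbf{Z}^d)\cap mP$ are discarded) is rapidly mixing.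
   Context: Model problem: for every positive integer $m$ one wants a connected graph whose vertex set is $(S+\mathbf{Z}^d)\cap mP$ and on which random walk mixes fast. Construction. (1) $Q$ is the polytope obtained from $P$ by pushing each defining hyperplane of $P$ outwards by at least $\sqrt{d/2}$, still defined by rational linear inequalities. (2) $H$ is a connected $d_H$-regular graph (self-loops and multiple edges allowed) whose $n_H$ vertices are in bijection with $\{z\in\mathbf{Z}^d : z+(1/2,\dots,1/2)\in Q\}$; $\lambda_H$ denotes the absolute value of the second largest eigenvalue of its normalized adjacency matrix (adjacency matrix divided by the degree). (3) For each $m$, $E_m$ is an $n_H$-regular graph on $n_E=n_S\cdot m^d$ vertices, with $\lambda_{E_m}$ the absolute value of the second largest eigenvalue of its normalized adjacency matrix; the $n_H$ edges at each vertex $v$ of $E_m$ are labelled by the vertices of $H$, giving a rotation map $\mathrm{Rot}(v,k)=(w,l)$ meaning the edge with label $k$ at $v$ leads to $w$ and carries label $l$ at $w$. (4) $G_m$ is the zig-zag product of $E_m$ and $H$: its vertex set is $V(E_m)\times V(H)$, it is $d_H^2$-regular, and for $(a,b)\in\{1,\dots,d_H\}^2$ the $(a,b)$-edge from $(v,k)$ goes to $(w,l)$ where $k'$ is the $a$-th neighbour of $k$ in $H$, $(w,l')=\mathrm{Rot}(v,k')$, and $l$ is the $b$-th neighbour of $l'$ in $H$. (5) Identifying $V(E_m)$ with $\{0,\dots,n_S-1\}\times\{0,\dots,m-1\}^d$ and $V(H)$ with the lattice points $z$ above, the vertex $((h,x),z)$ corresponds to the point $s_h+x+mz$; the vertices whose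 point lies in $(S+\mathbf{Z}^d)\cap mP$ are called relevant, the others irrelevant, and every point of $(S+\mathbf{Z}^d)\cap mP$ arises from a relevant vertex. The random walk is run on $G_m$, testing each visited vertex for relevance via the linear inequalities of $mP$ and discarding irrelevant ones; the proportion of irrelevant vertices tends to a constant $\varepsilon$ with $0<\varepsilon<1$. *)

theory Defs
  imports
    "HOL-Probability.Probability"
    "Jordan_Normal_Form.Char_Poly"
    "HOL-Computational_Algebra.Fundamental_Theorem_Algebra"
begin

no_notation vec_index (infixl "$" 100)

section \<open>Regular multigraphs with labelled edges\<close>

text \<open>
  Every vertex has exactly one outgoing edge for each label, so the degree is the number of labels.
  Loops and multiple edges are allowed; a loop is counted once for each label it carries.
\<close>

record ('v, 'e) mgraph =
  verts :: "'v set"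
  labels :: "'e set"
  nbr :: "'v \<Rightarrow> 'e \<Rightarrow> 'v"

definition adj :: "('v, 'e) mgraph \<Rightarrow> 'v \<Rightarrow> 'v \<Rightarrow> nat" where
  "adj G u v = card {e \<in> labels G. nbr G u e = v}"

text \<open>The last condition says that the graph is undirected.\<close>

definition regular_mgraph :: "('v, 'e) mgraph \<Rightarrow> bool" where
  "regular_mgraph G \<longleftrightarrow> finite (verts G) \<and> finite (labels G) \<and>
     (\<forall>v\<in>verts G. \<forall>e\<in>labels G. nbr G v e \<in> verts G) \<and>
     (\<forall>u\<in>verts G. \<forall>v\<in>verts G. adj G u v = adj G v u)"

definition connected_mgraph :: "('v, 'e) mgraph \<Rightarrow> bool" where
  "connected_mgraph G \<longleftrightarrow> verts G \<noteq> {} \<and>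
     (\<forall>u\<in>verts G. \<forall>v\<in>verts G.
        (u, v) \<in> {(x, nbr G x e) | x e. x \<in> verts G \<and> e \<in> labels G}\<^sup>*)"

text \<open>The rows and columns are indexed by an (arbitrary) enumeration of the vertices.\<close>

definition normalized_adj_mat :: "('v, 'e) mgraph \<Rightarrow> real mat" where
  "normalized_adj_mat G = Matrix.mat (card (verts G)) (card (verts G))
     (\<lambda>(i, j). real (adj G (from_nat_into (verts G) i) (from_nat_into (verts G) j))
              / real (card (labels G)))"

text \<open>
  The second entry of the list of absolute values of the eigenvalues, with multiplicity, in
  decreasing order. Thus the value is 1 for bipartite and for disconnected graphs. Graphs with
  fewer than two vertices get the value 0. The matrices of interest are symmetric, so that all
  roots of the characteristic polynomial are real.
\<close>

definition second_eigenvalue :: "('v, 'e) mgraph \<Rightarrow> real" where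
  "second_eigenvalue G =
     (let xs = rev (sorted_list_of_multiset
                 (image_mset abs (proots (char_poly (normalized_adj_mat G)))))
      in if length xs < 2 then 0 else xs ! 1)"

section \<open>Rotation maps and the zig-zag product\<close>

text \<open>
  \<open>rot (v, k) = (w, l)\<close>: the edge labelled \<open>k\<close> at \<open>v\<close> leads to \<open>w\<close> and carries the label \<open>l\<close> there.
\<close>

definition rotation_map :: "'v set \<Rightarrow> 'k set \<Rightarrow> ('v \<times> 'k \<Rightarrow> 'v \<times> 'k) \<Rightarrow> bool" where
  "rotation_map V K rot \<longleftrightarrow> (\<forall>p\<in>V \<times> K. rot p \<in> V \<times> K \<and> rot (rot p) = p)"

definition rotation_graph :: "'v set \<Rightarrow> 'k set \<Rightarrow> ('v \<times> 'k \<Rightarrow> 'v \<times> 'k) \<Rightarrow> ('v, 'k) mgraph" where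
  "rotation_graph V K rot = \<lparr>verts = V, labels = K, nbr = (\<lambda>v k. fst (rot (v, k)))\<rparr>"

definition zigzag ::
  "'v set \<Rightarrow> ('v \<times> 'k \<Rightarrow> 'v \<times> 'k) \<Rightarrow> ('k, 'e) mgraph \<Rightarrow> ('v \<times> 'k, 'e \<times> 'e) mgraph" where
  "zigzag V rot H =
     \<lparr>verts = V \<times> verts H,
      labels = labels H \<times> labels H,
      nbr = (\<lambda>(v, k) (a, b).
               let k' = nbr H k a; (w, l') = rot (v, k') in (w, nbr H l' b))\<rparr>"

section \<open>Random walks and mixing\<close>

primrec walk :: "('v, 'e) mgraph \<Rightarrow> 'v \<Rightarrow> nat \<Rightarrow> 'v pmf" where
  "walk G u 0 = return_pmf u"
| "walk G u (Suc t) = bind_pmf (walk G u t) (\<lambda>v. map_pmf (nbr G v) (pmf_of_set (labels G)))"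

definition tv_dist :: "'a pmf \<Rightarrow> 'a pmf \<Rightarrow> real" where
  "tv_dist p q = (SUP A. \<bar>measure_pmf.prob p A - measure_pmf.prob q A\<bar>)"

text \<open>
  \<open>law m u t\<close> is a distribution obtained from the first \<open>t\<close> steps of a walk on \<open>G m\<close> started at \<open>u\<close>.
  Rapid mixing: a number of steps logarithmic in the size of \<open>G m\<close> and in the inverse of the
  accuracy suffices, uniformly in the starting vertex and for all sufficiently large \<open>m\<close>.
\<close>

definition rapidly_mixing ::
  "(nat \<Rightarrow> ('v, 'e) mgraph) \<Rightarrow> (nat \<Rightarrow> 'v \<Rightarrow> nat \<Rightarrow> 'w pmf) \<Rightarrow> (nat \<Rightarrow> 'w pmf) \<Rightarrow> bool" where
  "rapidly_mixing G law limit \<longleftrightarrow>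
     (\<exists>C. \<forall>\<^sub>F m in sequentially. \<forall>u\<in>verts (G m). \<forall>\<epsilon>. 0 < \<epsilon> \<and> \<epsilon> < 1 \<longrightarrow>
        (\<forall>t. real t \<ge> C * (ln (real (card (verts (G m)))) + ln (1 / \<epsilon>)) \<longrightarrow>
           tv_dist (law m u t) (limit m) \<le> \<epsilon>))"

section \<open>Lattice points in dilated polytopes\<close>

definition of_int_vec :: "int ^ 'd \<Rightarrow> real ^ 'd" where
  "of_int_vec z = (\<chi> i. of_int (z $ i))"

definition rational_vec :: "real ^ 'd \<Rightarrow> bool" where
  "rational_vec v \<longleftrightarrow> (\<forall>i. v $ i \<in> \<rat>)"

definition polyhedron_of :: "nat \<Rightarrow> (nat \<Rightarrow> real ^ 'd) \<Rightarrow> (nat \<Rightarrow> real) \<Rightarrow> (real ^ 'd) set" where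
  "polyhedron_of r a b = {x. \<forall>i<r. a i \<bullet> x \<le> b i}"

text \<open>The set \<open>(S + \<int>\<^sup>d) \<inter> mP\<close>.\<close>

definition sample_points :: "(real ^ 'd) set \<Rightarrow> (real ^ 'd) set \<Rightarrow> nat \<Rightarrow> (real ^ 'd) set" where
  "sample_points S P m = {p + of_int_vec z | p z. p \<in> S} \<inter> (\<lambda>x. real m *\<^sub>R x) ` P"

text \<open>The set \<open>{0, \<dots>, n - 1} \<times> {0, \<dots>, m - 1}\<^sup>d\<close>.\<close>

definition E_verts :: "nat \<Rightarrow> nat \<Rightarrow> (nat \<times> (int ^ 'd)) set" where
  "E_verts n m = {..<n} \<times> {x. \<forall>i. 0 \<le> x $ i \<and> x $ i < int m}"

definition vertex_point ::
  "(nat \<Rightarrow> real ^ 'd) \<Rightarrow> nat \<Rightarrow> (nat \<times> (int ^ 'd)) \<times> (int ^ 'd) \<Rightarrow> real ^ 'd" where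
  "vertex_point s m = (\<lambda>((h, x), z). s h + of_int_vec x + real m *\<^sub>R of_int_vec z)"

text \<open>
  The law of the point of \<open>X\<close> carried by the vertex visited at time \<open>t\<close>, given that this vertex is
  relevant, that is, is not discarded.
\<close>

definition retained_law ::
  "('v, 'e) mgraph \<Rightarrow> ('v \<Rightarrow> 'w) \<Rightarrow> 'w set \<Rightarrow> 'v \<Rightarrow> nat \<Rightarrow> 'w pmf" where
  "retained_law G pt X u t =
     map_pmf pt (cond_pmf (walk G u t) {v \<in> verts G. pt v \<in> X})"

end

theory Submission
  imports Defs
begin

text \<open>
  For a regular graph let \<open>M\<close> be the averaging operator on functions. The second eigenvalue is the
  norm of \<open>M\<close> on the functions of mean zero: the matrix \<open>M - J/N\<close> has the same characteristic
  polynomial as \<open>M\<close> up to exchanging one root 1 for 0, and a maximiser of the norm of a symmetric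
  operator on the unit sphere yields an eigenvector.

  Write the walk on the zig-zag product as \<open>B R B\<close>, where \<open>B\<close> averages over the edges of \<open>H\<close> in each
  fibre \<open>{v} \<times> V(H)\<close> and \<open>R\<close> is the permutation given by the rotation map. With \<open>h\<close> and \<open>e\<close> the norms
  for \<open>H\<close> and \<open>E\<close>, splitting a function of mean zero into its fibre means and the rest shows that the
  fibre means of \<open>R B x\<close> have squared norm at most \<open>(e\<^sup>2 + h\<^sup>2) |x|\<^sup>2\<close>, and hence that
  \<open>|B R B x|\<^sup>2 \<le> (h\<^sup>2 + (1 - h\<^sup>2) (e\<^sup>2 + h\<^sup>2)) |x|\<^sup>2\<close>. As \<open>e + h\<close> stays below \<open>0.995\<close>, the factor is
  bounded away from 1.

  A norm below 1 makes the distance to uniformity decay exponentially. Conditioning on relevance costs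
  only a constant factor, because \<open>P\<close> contains a cube and so the relevant vertices have density bounded
  below.
\<close>

section \<open>The second eigenvalue as an operator norm\<close>

text \<open>The second factor depends only on differences of entries within a column, so adding a
  constant to a whole column does not change it. This is what lets two matrices with different row
  sums share all roots but one.\<close>

lemma char_poly_row_sum:
  fixes B :: "'a :: field mat"
  assumes B: "B \<in> carrier_mat (Suc m) (Suc m)"
    and row: "\<And>i. i < Suc m \<Longrightarrow> (\<Sum>j<Suc m. B $$ (i, j)) = \<rho>"
  shows "char_poly B = [:- \<rho>, 1:] *
    char_poly (Matrix.mat m m (\<lambda>(i, j). B $$ (Suc i, Suc j) - B $$ (0, Suc j)))"
proof -
  \<comment> \<open>Conjugate by the identity matrix with its first column replaced by the all-ones vector,
    which is an eigenvector.\<close>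
  define T :: "'a mat" where
    "T = Matrix.mat (Suc m) (Suc m) (\<lambda>(i, j). if j = 0 \<or> i = j then 1 else 0)"
  define T' :: "'a mat" where
    "T' = Matrix.mat (Suc m) (Suc m) (\<lambda>(i, j). if i = j then 1 else if j = 0 then - 1 else 0)"
  define D where "D = Matrix.mat m m (\<lambda>(i, j). B $$ (Suc i, Suc j) - B $$ (0, Suc j))"
  define C where "C = four_block_mat (Matrix.mat 1 1 (\<lambda>_. \<rho>))
    (Matrix.mat 1 m (\<lambda>(i, j). B $$ (0, Suc j))) (0\<^sub>m m 1) D"
  have carr [simp]: "T \<in> carrier_mat (Suc m) (Suc m)" "T' \<in> carrier_mat (Suc m) (Suc m)"
    "D \<in> carrier_mat m m" "C \<in> carrier_mat (Suc m) (Suc m)"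
    unfolding T_def T'_def D_def C_def by auto
  have C: "C $$ (i, j) = (if j = 0 then (if i = 0 then \<rho> else 0) else
      if i = 0 then B $$ (0, j) else B $$ (i, j) - B $$ (0, j))"
    if "i < Suc m" "j < Suc m" for i j
    using that unfolding C_def D_def by (cases i; cases j) auto
  have sumT: "(\<Sum>k\<in>{0..<Suc m}. (if k = 0 \<or> i = k then 1 else 0) * f k) =
      f 0 + (if i = 0 then 0 else f i)" if "i < Suc m" for i and f :: "nat \<Rightarrow> 'a"
  proof -
    have "(\<Sum>k\<in>{0..<Suc m}. (if k = 0 \<or> i = k then 1 else 0) * f k) =
      (\<Sum>k\<in>{0..<Suc m}. (if k = 0 then f k else 0) + (if k = i then (if i = 0 then 0 else f k) else 0))"
      by (intro sum.cong) auto
    also have "\<dots> = f 0 + (if i = 0 then 0 else f i)"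
      using that by (simp add: sum.distrib del: sum.op_ivl_Suc)
    finally show ?thesis .
  qed
  have TT': "T * T' = 1\<^sub>m (Suc m)"
  proof (rule eq_matI)
    fix i j assume ij: "i < dim_row (1\<^sub>m (Suc m) :: 'a mat)" "j < dim_col (1\<^sub>m (Suc m) :: 'a mat)"
    then have "(T * T') $$ (i, j) = (\<Sum>k\<in>{0..<Suc m}. (if k = 0 \<or> i = k then 1 else 0) *
      (if k = j then 1 else if j = 0 then - 1 else 0))"
      unfolding T_def T'_def by (simp add: scalar_prod_def del: sum.op_ivl_Suc)
    also have "\<dots> = 1\<^sub>m (Suc m) $$ (i, j)"
      using ij by (subst sumT) auto
    finally show "(T * T') $$ (i, j) = 1\<^sub>m (Suc m) $$ (i, j)" .
  qed (auto simp: T_def T'_def)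
  then have T'T: "T' * T = 1\<^sub>m (Suc m)"
    by (rule mat_mult_left_right_inverse [OF carr(1,2)])
  have BT: "B * T = T * C"
  proof (rule eq_matI)
    fix i j assume "i < dim_row (T * C)" "j < dim_col (T * C)"
    then have ij: "i < Suc m" "j < Suc m" by (auto simp: T_def C_def D_def)
    have "(B * T) $$ (i, j) = (\<Sum>k\<in>{0..<Suc m}. B $$ (i, k) * (if j = 0 \<or> k = j then 1 else 0))"
      using ij B unfolding T_def by (auto simp: scalar_prod_def simp del: sum.op_ivl_Suc intro!: sum.cong)
    also have "\<dots> = (if j = 0 then \<rho> else B $$ (i, j))"
    proof (cases "j = 0")
      case True
      then show ?thesis using row[OF ij(1)] by (simp add: lessThan_atLeast0 del: sum.op_ivl_Suc)
    next
      case False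
      have "(\<Sum>k\<in>{0..<Suc m}. B $$ (i, k) * (if j = 0 \<or> k = j then 1 else 0)) =
        (\<Sum>k\<in>{0..<Suc m}. if k = j then B $$ (i, k) else 0)"
        using False by (intro sum.cong) auto
      then show ?thesis using ij False by (simp del: sum.op_ivl_Suc)
    qed
    also have "\<dots> = (\<Sum>k\<in>{0..<Suc m}. (if k = 0 \<or> i = k then 1 else 0) * C $$ (k, j))"
      using ij by (subst sumT) (auto simp: C)
    also have "\<dots> = (T * C) $$ (i, j)"
      using ij carr(4) unfolding T_def 
      by (auto simp: scalar_prod_def simp del: sum.op_ivl_Suc carr intro!: sum.cong)
    finally show "(B * T) $$ (i, j) = (T * C) $$ (i, j)" .
  qed (use B in \<open>auto simp: T_def C_def D_def\<close>)
  have "T * C * T' = B"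
    unfolding BT[symmetric] using assoc_mult_mat[OF B carr(1,2)] TT' B by simp
  then have "similar_mat_wit B C T T'"
    using TT' T'T B by (intro similar_mat_witI) auto
  then have "char_poly B = char_poly C"
    using char_poly_similar unfolding similar_mat_def by blast
  also have "\<dots> = char_poly (Matrix.mat 1 1 (\<lambda>_. \<rho>) :: 'a mat) * char_poly D"
    unfolding C_def by (rule char_poly_four_block_zeros_col) auto
  also have "char_poly (Matrix.mat 1 1 (\<lambda>_. \<rho>) :: 'a mat) = [:- \<rho>, 1:]"
    by (subst char_poly_upper_triangular[of _ 1]) (auto simp: diag_mat_def)
  finally show ?thesis unfolding D_def .
qed

definition avg_op :: "('v, 'e) mgraph \<Rightarrow> ('v \<Rightarrow> real) \<Rightarrow> 'v \<Rightarrow> real" where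
  "avg_op G f u = (\<Sum>e\<in>labels G. f (nbr G u e)) / real (card (labels G))"

text \<open>For a finite vertex set this bounds the operator norm of averaging on functions of mean
  zero by the absolute value of \<open>c\<close>. Squared norms keep square roots out of the
  calculations.\<close>

definition contracts :: "('v, 'e) mgraph \<Rightarrow> real \<Rightarrow> bool" where
  "contracts G c \<longleftrightarrow> (\<forall>f. (\<Sum>v\<in>verts G. f v) = 0 \<longrightarrow>
     (\<Sum>v\<in>verts G. (avg_op G f v)\<^sup>2) \<le> c\<^sup>2 * (\<Sum>v\<in>verts G. (f v)\<^sup>2))"

text \<open>If the second entry exceeded \<open>c\<close>, so would the first; neither could then
  lie in \<open>R\<close>, yet only one copy of \<open>y\<close> is available outside
  \<open>R\<close>.\<close>

lemma second_entry_le: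
  fixes R :: "real multiset"
  assumes "\<And>x. x \<in># R \<Longrightarrow> x \<le> c" and "xs = rev (sorted_list_of_multiset (add_mset y R))"
    and "length xs \<ge> 2"
  shows "xs ! 1 \<le> c"
proof (rule ccontr)
  assume *: "\<not> xs ! 1 \<le> c"
  obtain p q ys where xs: "xs = p # q # ys"
    using assms(3) by (cases xs; cases "tl xs") auto
  have "sorted (rev xs)" using assms(2) by (metis rev_rev_ident sorted_sorted_list_of_multiset)
  then have "q \<le> p" unfolding xs by (simp add: sorted_append)
  have m: "mset xs = add_mset y R" using assms(2) by simp
  have "p \<notin># R" "q \<notin># R" using * \<open>q \<le> p\<close> assms(1) xs by force+
  moreover have "p \<in># add_mset y R" unfolding m[symmetric] xs by simp
  ultimately have "p = y" by simp
  then have "R = mset (q # ys)" using m xs by simp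
  with \<open>q \<notin># R\<close> show False by simp
qed

text \<open>All entries from the second position on are below \<open>y\<close>, so \<open>y\<close>
  stands first and \<open>R\<close> fills the remaining positions.\<close>

lemma le_second_entry:
  fixes R :: "real multiset"
  assumes "xs = rev (sorted_list_of_multiset (add_mset y R))"
    and "xs ! 1 < y" and "x \<in># R"
  shows "x \<le> xs ! 1"
proof -
  have m: "mset xs = add_mset y R" using assms(1) by simp
  have "size (mset xs) \<ge> 2" unfolding m using assms(3) by (cases R) auto
  then obtain p q ys where xs: "xs = p # q # ys"
    by (cases xs; cases "tl xs") auto
  have "sorted (rev xs)" using assms(1) by (metis rev_rev_ident sorted_sorted_list_of_multiset)
  then have le: "z \<le> q" if "z \<in> set (q # ys)" for z
    using that unfolding xs by (auto simp: sorted_append)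
  have "y \<in># mset xs" using m by simp
  then have "y = p" using assms(2) le xs by force
  then have "R = mset (q # ys)" using m xs by simp
  then show ?thesis using assms(3) le xs by force
qed

lemma second_eigenvalue_nonneg: "0 \<le> second_eigenvalue G"
proof -
  define R where "R = image_mset abs (proots (char_poly (normalized_adj_mat G)))"
  have "xs ! 1 \<in># R" if "xs = rev (sorted_list_of_multiset R)" "\<not> length xs < 2" for xs
  proof -
    have "xs ! 1 \<in> set xs" using that(2) by simp
    then show ?thesis using that(1) by simp
  qed
  moreover have "0 \<le> x" if "x \<in># R" for x using that unfolding R_def by auto
  ultimately show ?thesis
    unfolding second_eigenvalue_def R_def[symmetric] Let_def by auto
qed

lemma contracts_mono:
  assumes "contracts G c" "0 \<le> c" "c \<le> c'"
  shows "contracts G c'"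
  unfolding contracts_def
proof (intro allI impI)
  fix f :: "_ \<Rightarrow> real" assume "(\<Sum>v\<in>verts G. f v) = 0"
  then have "(\<Sum>v\<in>verts G. (avg_op G f v)\<^sup>2) \<le> c\<^sup>2 * (\<Sum>v\<in>verts G. (f v)\<^sup>2)"
    using assms(1) unfolding contracts_def by blast
  also have "\<dots> \<le> c'\<^sup>2 * (\<Sum>v\<in>verts G. (f v)\<^sup>2)"
    using assms by (intro mult_right_mono power_mono sum_nonneg) auto
  finally show "(\<Sum>v\<in>verts G. (avg_op G f v)\<^sup>2) \<le> c'\<^sup>2 * (\<Sum>v\<in>verts G. (f v)\<^sup>2)" .
qed

section \<open>The averaging operator and its mean-free variant\<close>

locale regular_graph =
  fixes G :: "('v, 'e) mgraph"
  assumes reg: "regular_mgraph G" and V_ne: "verts G \<noteq> {}" and L_ne: "labels G \<noteq> {}"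
begin

abbreviation "V \<equiv> verts G"
abbreviation "N \<equiv> card (verts G)"
abbreviation "deg \<equiv> card (labels G)"

lemma finV [simp]: "finite V" and finL [simp]: "finite (labels G)"
  using reg unfolding regular_mgraph_def by auto

lemma nbr_in [simp]: "v \<in> V \<Longrightarrow> e \<in> labels G \<Longrightarrow> nbr G v e \<in> V"
  using reg unfolding regular_mgraph_def by auto

lemma adj_sym: "u \<in> V \<Longrightarrow> v \<in> V \<Longrightarrow> adj G u v = adj G v u"
  using reg unfolding regular_mgraph_def by auto

lemma N_pos: "N > 0"
  using V_ne by (auto simp: card_gt_0_iff)

text \<open>Grouping the labels by the vertex they lead to turns the average over labels into
  multiplication by the normalized adjacency matrix.\<close>

lemma avg_op_adj:
  assumes "u \<in> V"
  shows "avg_op G f u = (\<Sum>v\<in>V. real (adj G u v) / real deg * f v)"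
proof -
  have "(\<Sum>e\<in>labels G. f (nbr G u e)) =
      (\<Sum>v\<in>V. \<Sum>e | e \<in> labels G \<and> nbr G u e = v. f (nbr G u e))"
    by (rule sum.group[symmetric]) (use assms in auto)
  also have "\<dots> = (\<Sum>v\<in>V. real (adj G u v) * f v)"
    by (intro sum.cong) (auto simp: adj_def)
  finally show ?thesis
    unfolding avg_op_def by (simp add: sum_divide_distrib)
qed

lemma avg_op_symmetric: "(\<Sum>u\<in>V. avg_op G f u * g u) = (\<Sum>u\<in>V. f u * avg_op G g u)"
proof -
  have "(\<Sum>u\<in>V. avg_op G f u * g u) = (\<Sum>u\<in>V. \<Sum>v\<in>V. real (adj G u v) / real deg * f v * g u)"
    by (intro sum.cong) (auto simp: avg_op_adj sum_distrib_right)
  also have "\<dots> = (\<Sum>v\<in>V. \<Sum>u\<in>V. real (adj G u v) / real deg * f v * g u)"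
    by (rule sum.swap)
  also have "\<dots> = (\<Sum>u\<in>V. f u * avg_op G g u)"
    by (intro sum.cong) (auto simp: avg_op_adj sum_distrib_left adj_sym mult_ac intro!: sum.cong)
  finally show ?thesis .
qed

lemma avg_op_const [simp]: "avg_op G (\<lambda>_. c) u = c"
  using L_ne by (simp add: avg_op_def)

lemma avg_op_linear: "avg_op G (\<lambda>v. a * f v + b * g v) u = a * avg_op G f u + b * avg_op G g u"
  by (simp add: avg_op_def sum.distrib add_divide_distrib flip: sum_distrib_left)

lemma sum_avg_op: "(\<Sum>u\<in>V. avg_op G f u) = (\<Sum>u\<in>V. f u)"
  using avg_op_symmetric[of f "\<lambda>_. 1"] by simp

lemma sum_row: "u \<in> V \<Longrightarrow> (\<Sum>v\<in>V. real (adj G u v) / real deg) = 1"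
  using avg_op_adj[of u "\<lambda>_. 1"] by simp

definition mean :: "('v \<Rightarrow> real) \<Rightarrow> real" where
  "mean f = (\<Sum>v\<in>V. f v) / real N"

text \<open>Subtracting the mean replaces the eigenvalue 1 of the constants by 0 and leaves the rest of
  the spectrum alone, so that no orthogonality to the constants has to be carried along.\<close>

definition dev_op :: "('v \<Rightarrow> real) \<Rightarrow> 'v \<Rightarrow> real" where
  "dev_op f u = avg_op G f u - mean f"

lemma sum_mean: "(\<Sum>v\<in>V. f v - mean f) = 0"
  using N_pos by (simp add: mean_def sum_subtractf)

text \<open>Pythagoras: constants are orthogonal to functions of mean zero.\<close>

lemma sum_square_decomp:
  "(\<Sum>v\<in>V. (f v)\<^sup>2) = real N * (mean f)\<^sup>2 + (\<Sum>v\<in>V. (f v - mean f)\<^sup>2)"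
proof -
  have "(\<Sum>v\<in>V. (f v - mean f)\<^sup>2) = (\<Sum>v\<in>V. (f v)\<^sup>2) - 2 * mean f * (\<Sum>v\<in>V. f v) + real N * (mean f)\<^sup>2"
    by (simp add: power2_diff sum.distrib sum_subtractf sum_distrib_left mult_ac)
  also have "(\<Sum>v\<in>V. f v) = real N * mean f"
    using N_pos by (simp add: mean_def)
  finally show ?thesis by (simp add: power2_eq_square)
qed

lemma dev_op_eq: "dev_op f u = avg_op G (\<lambda>v. f v - mean f) u"
  using avg_op_linear[of 1 f "-1" "\<lambda>_. mean f" u] by (simp add: dev_op_def)

text \<open>Averaging fixes constants, so \<open>dev_op f\<close> is the average of the mean-free
  part of \<open>f\<close>, whose norm is at most that of \<open>f\<close>.\<close>

lemma contracts_dev_op: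
  assumes "contracts G c"
  shows "(\<Sum>v\<in>V. (dev_op f v)\<^sup>2) \<le> c\<^sup>2 * (\<Sum>v\<in>V. (f v)\<^sup>2)"
proof -
  have "(\<Sum>v\<in>V. (dev_op f v)\<^sup>2) \<le> c\<^sup>2 * (\<Sum>v\<in>V. (f v - mean f)\<^sup>2)"
    unfolding dev_op_eq using assms sum_mean unfolding contracts_def by blast
  also have "\<dots> \<le> c\<^sup>2 * (\<Sum>v\<in>V. (f v)\<^sup>2)"
    by (intro mult_left_mono) (auto simp: sum_square_decomp[of f])
  finally show ?thesis .
qed

lemma dev_op_linear: "dev_op (\<lambda>v. a * f v + b * g v) u = a * dev_op f u + b * dev_op g u"
  by (simp add: dev_op_def mean_def avg_op_linear sum.distrib add_divide_distrib algebra_simps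
      flip: sum_distrib_left)

lemma dev_op_symmetric: "(\<Sum>u\<in>V. dev_op f u * g u) = (\<Sum>u\<in>V. f u * dev_op g u)"
proof -
  have "(\<Sum>u\<in>V. dev_op f u * g u) = (\<Sum>u\<in>V. avg_op G f u * g u) - mean f * (\<Sum>u\<in>V. g u)"
    by (simp add: dev_op_def left_diff_distrib sum_subtractf sum_distrib_left)
  also have "\<dots> = (\<Sum>u\<in>V. f u * avg_op G g u) - (\<Sum>u\<in>V. f u) * mean g"
    by (simp add: avg_op_symmetric mean_def)
  also have "\<dots> = (\<Sum>u\<in>V. f u * dev_op g u)"
    by (simp add: dev_op_def right_diff_distrib sum_subtractf sum_distrib_right)
  finally show ?thesis .
qed

lemma dev_op_adj:
  "u \<in> V \<Longrightarrow> dev_op f u = (\<Sum>v\<in>V. (real (adj G u v) / real deg - 1 / real N) * f v)"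
  by (simp add: dev_op_def avg_op_adj mean_def left_diff_distrib sum_subtractf sum_divide_distrib)

section \<open>Eigenvalues of the matrix and of the operator\<close>

definition enum :: "nat \<Rightarrow> 'v" where "enum = from_nat_into V"

lemma enum_bij: "bij_betw enum {..<N} V"
  unfolding enum_def by (rule bij_betw_from_nat_into_finite) simp

lemma enum_in [simp]: "i < N \<Longrightarrow> enum i \<in> V"
  using enum_bij by (auto simp: bij_betw_def)

lemma sum_enum: "(\<Sum>i<N. f (enum i)) = (\<Sum>v\<in>V. f v)"
  by (rule sum.reindex_bij_betw[OF enum_bij])

definition dev_mat :: "real mat" where
  "dev_mat = Matrix.mat N N (\<lambda>(i, j). real (adj G (enum i) (enum j)) / real deg - 1 / real N)"

text \<open>Both matrices have constant row sums, 1 and 0, and differ entrywise by the constant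
  \<open>1 / real N\<close>. Splitting off these row sums as roots leaves the same factor in both
  characteristic polynomials.\<close>

lemma proots_char_polys:
  obtains R where "proots (char_poly (normalized_adj_mat G)) = add_mset 1 R"
    and "proots (char_poly dev_mat) = add_mset 0 R"
proof -
  obtain m where m: "N = Suc m" using N_pos gr0_implies_Suc by blast
  define M where "M = normalized_adj_mat G"
  have M: "M = Matrix.mat N N (\<lambda>(i, j). real (adj G (enum i) (enum j)) / real deg)"
    unfolding M_def normalized_adj_mat_def enum_def ..
  have dimM: "M \<in> carrier_mat (Suc m) (Suc m)" unfolding M m by simp
  define D where "D = Matrix.mat m m (\<lambda>(i, j). M $$ (Suc i, Suc j) - M $$ (0, Suc j))"
  have row: "(\<Sum>j<N. real (adj G (enum i) (enum j)) / real deg) = 1" if "i < N" for i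
    using sum_enum[of "\<lambda>v. real (adj G (enum i) v) / real deg"] sum_row[of "enum i"] that by simp
  have 1: "char_poly M = [:- 1, 1:] * char_poly D"
    unfolding D_def by (rule char_poly_row_sum[OF dimM]) (use row in \<open>simp add: M m\<close>)
  have "char_poly dev_mat = [:- 0, 1:] *
    char_poly (Matrix.mat m m (\<lambda>(i, j). dev_mat $$ (Suc i, Suc j) - dev_mat $$ (0, Suc j)))"
  proof (rule char_poly_row_sum)
    fix i assume "i < Suc m"
    then have "(\<Sum>j<Suc m. dev_mat $$ (i, j)) = (\<Sum>j<N. real (adj G (enum i) (enum j)) / real deg) - 1"
      unfolding dev_mat_def by (simp add: m sum_subtractf del: sum.lessThan_Suc)
    then show "(\<Sum>j<Suc m. dev_mat $$ (i, j)) = 0" using row[of i] \<open>i < Suc m\<close> m by simp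
  qed (simp add: dev_mat_def m)
  also have "Matrix.mat m m (\<lambda>(i, j). dev_mat $$ (Suc i, Suc j) - dev_mat $$ (0, Suc j)) = D"
    unfolding D_def dev_mat_def M m by (intro eq_matI) auto
  finally have 2: "char_poly dev_mat = [:- 0, 1:] * char_poly D" .
  have "D \<in> carrier_mat m m" by (simp add: D_def)
  then have "char_poly D \<noteq> 0" by (auto dest!: degree_monic_char_poly)
  have lin: "proots [:- a, 1:] = {#a#}" for a :: real
    by simp
  show thesis
  proof (rule that)
    show "proots (char_poly (normalized_adj_mat G)) = add_mset 1 (proots (char_poly D))"
      using 1 \<open>char_poly D \<noteq> 0\<close> lin[of 1] unfolding M_def by (subst 1[unfolded M_def], subst proots_mult) auto
    show "proots (char_poly dev_mat) = add_mset 0 (proots (char_poly D))"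
      using \<open>char_poly D \<noteq> 0\<close> lin[of 0] by (subst 2, subst proots_mult) auto
  qed
qed

text \<open>Translates between vectors indexed by the enumeration and functions on vertices, so that
  the spectral argument can be made with functions alone. Values outside \<open>V\<close> are
  arbitrary, hence the nonzero value is required at a vertex.\<close>

lemma dev_mat_eigen:
  "r \<in># proots (char_poly dev_mat) \<longleftrightarrow> (\<exists>f. (\<exists>v\<in>V. f v \<noteq> 0) \<and> (\<forall>u\<in>V. dev_op f u = r * f u))"
    (is "?L \<longleftrightarrow> ?R")
proof -
  have dim: "dev_mat \<in> carrier_mat N N" by (simp add: dev_mat_def)
  then have "char_poly dev_mat \<noteq> 0" by (auto dest!: degree_monic_char_poly)
  then have "?L \<longleftrightarrow> eigenvalue dev_mat r"
    by (simp add: eigenvalue_root_char_poly[OF dim])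
  also have "\<dots> \<longleftrightarrow> ?R"
  proof
    assume "eigenvalue dev_mat r"
    then obtain w where w: "w \<in> carrier_vec N" "w \<noteq> 0\<^sub>v N" "dev_mat *\<^sub>v w = r \<cdot>\<^sub>v w"
      unfolding eigenvalue_def eigenvector_def using dim by auto
    define f where "f v = vec_index w (the_inv_into {..<N} enum v)" for v
    have f: "f (enum i) = vec_index w i" if "i < N" for i
      using that enum_bij unfolding f_def by (subst the_inv_into_f_f) (auto simp: bij_betw_def)
    obtain i where i: "i < N" "vec_index w i \<noteq> 0"
      using w(1,2) by (metis carrier_vecD eq_vecI index_zero_vec)
    have "dev_op f u = r * f u" if u: "u \<in> V" for u
    proof -
      obtain k where k: "k < N" "u = enum k" using u enum_bij by (auto simp: bij_betw_def)
      have "dev_op f u = (\<Sum>j<N. (real (adj G u (enum j)) / real deg - 1 / real N) * f (enum j))"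
        using u by (simp add: dev_op_adj sum_enum[of "\<lambda>v. (real (adj G u v) / real deg - 1 / real N) * f v"])
      also have "\<dots> = vec_index (dev_mat *\<^sub>v w) k"
        using w(1) k dim by (auto simp: scalar_prod_def lessThan_atLeast0 dev_mat_def f intro!: sum.cong)
      also have "\<dots> = r * f u" using w k by (simp add: f)
      finally show ?thesis .
    qed
    then show ?R using i f enum_in by metis
  next
    assume ?R
    then obtain f v where f: "v \<in> V" "f v \<noteq> 0" "\<And>u. u \<in> V \<Longrightarrow> dev_op f u = r * f u" by blast
    define w where "w = Matrix.vec N (\<lambda>i. f (enum i))"
    have "w \<noteq> 0\<^sub>v N"
    proof -
      obtain i where "i < N" "v = enum i" using f enum_bij by (auto simp: bij_betw_def)
      then have "vec_index w i \<noteq> 0" using f by (simp add: w_def)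
      with \<open>i < N\<close> show ?thesis by auto
    qed
    moreover have "dev_mat *\<^sub>v w = r \<cdot>\<^sub>v w"
    proof (rule eq_vecI)
      fix k assume "k < dim_vec (r \<cdot>\<^sub>v w)"
      then have k: "k < N" by (simp add: w_def)
      have "vec_index (dev_mat *\<^sub>v w) k =
        (\<Sum>j<N. (real (adj G (enum k) (enum j)) / real deg - 1 / real N) * f (enum j))"
        using k dim by (auto simp: scalar_prod_def lessThan_atLeast0 dev_mat_def w_def intro!: sum.cong)
      also have "\<dots> = dev_op f (enum k)"
        using k by (simp add: dev_op_adj
          sum_enum[of "\<lambda>v. (real (adj G (enum k) v) / real deg - 1 / real N) * f v"])
      also have "\<dots> = vec_index (r \<cdot>\<^sub>v w) k" using k f by (simp add: w_def)
      finally show "vec_index (dev_mat *\<^sub>v w) k = vec_index (r \<cdot>\<^sub>v w) k" .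
    qed (use dim in \<open>simp add: w_def\<close>)
    ultimately show "eigenvalue dev_mat r"
      unfolding eigenvalue_def eigenvector_def using dim by (intro exI[of _ w]) (auto simp: w_def)
  qed
  finally show ?thesis .
qed

text \<open>Each root in \<open>R\<close> belongs to an eigenfunction of \<open>dev_op\<close> and
  is therefore at most \<open>c\<close> in absolute value; only the split-off root 1 can be larger,
  and it takes up at most one place of the list.\<close>

lemma second_eigenvalue_le:
  assumes c: "contracts G c" "0 \<le> c"
  shows "second_eigenvalue G \<le> c"
proof -
  obtain R where R: "proots (char_poly (normalized_adj_mat G)) = add_mset 1 R"
    "proots (char_poly dev_mat) = add_mset 0 R" by (rule proots_char_polys)
  have le: "\<bar>r\<bar> \<le> c" if "r \<in># R" for r
  proof -
    have "r \<in># proots (char_poly dev_mat)" using that R(2) by simp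
    then obtain f v where f: "v \<in> V" "f v \<noteq> 0" "\<And>u. u \<in> V \<Longrightarrow> dev_op f u = r * f u"
      unfolding dev_mat_eigen by blast
    have "r\<^sup>2 * (\<Sum>v\<in>V. (f v)\<^sup>2) = (\<Sum>v\<in>V. (dev_op f v)\<^sup>2)"
      by (simp add: f sum_distrib_left power_mult_distrib)
    also have "\<dots> \<le> c\<^sup>2 * (\<Sum>v\<in>V. (f v)\<^sup>2)" by (rule contracts_dev_op[OF c(1)])
    finally have "r\<^sup>2 \<le> c\<^sup>2"
      using f sum_pos2[OF finV f(1), of "\<lambda>v. (f v)\<^sup>2"] by simp
    then show ?thesis using c(2) abs_le_square_iff[of r c] by simp
  qed
  \<comment> \<open>A list with a single entry yields the default value 0, which
    \<open>0 \<le> c\<close> covers.\<close>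
  show ?thesis
    unfolding second_eigenvalue_def Let_def R(1)
    using second_entry_le[of "image_mset abs R" c _ 1, OF _ refl] le c
    by (auto simp: not_less simp del: sorted_list_of_multiset_insert)
qed

end

section \<open>Attaining the operator norm at an eigenvalue\<close>

text \<open>Tychonoff's theorem. Pinning the values outside \<open>V\<close> to 0 is what makes the
  set compact in the product topology on all functions.\<close>

lemma compact_functions_on:
  fixes V :: "'v set"
  shows "compact {f :: 'v \<Rightarrow> real. \<forall>v. f v \<in> (if v \<in> V then {-1..1} else {0})}"
proof -
  have "compactin (product_topology (\<lambda>_::'v. euclidean :: real topology) UNIV)
      (PiE UNIV (\<lambda>v. if v \<in> V then {-1..1} else {0}))"
    by (subst compactin_PiE) auto
  then show ?thesis
    unfolding euclidean_product_topology by (simp add: compactin_euclidean_iff PiE_def Pi_def)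
qed

text \<open>At \<open>t = - b / (c + 1)\<close> the quadratic would be negative unless
  \<open>b = 0\<close>; the added 1 keeps the denominator positive when
  \<open>c = 0\<close>.\<close>

lemma linear_coeff_eq_0:
  fixes b c :: real
  assumes "\<And>t. 0 \<le> 2 * t * b + t\<^sup>2 * c" and "0 \<le> c"
  shows "b = 0"
proof (rule ccontr)
  assume "b \<noteq> 0"
  define d where "d = b / (c + 1)"
  have b: "b = d * (c + 1)" using assms(2) by (simp add: d_def)
  have "0 \<le> 2 * (- d) * b + (- d)\<^sup>2 * c" by (rule assms(1))
  also have "\<dots> = - (d\<^sup>2 * (c + 2))" by (simp add: b algebra_simps power2_eq_square)
  finally have "d\<^sup>2 * (c + 2) \<le> 0" by simp
  then have "d = 0" using assms(2) by (auto simp: mult_le_0_iff)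
  then show False using \<open>b \<noteq> 0\<close> b by simp
qed

context regular_graph
begin

lemma dev_op_cong: "(\<And>v. v \<in> V \<Longrightarrow> f v = g v) \<Longrightarrow> u \<in> V \<Longrightarrow> dev_op f u = dev_op g u"
  by (simp add: dev_op_adj)

lemma dev_op_scale: "dev_op (\<lambda>v. a * f v) u = a * dev_op f u"
  using dev_op_linear[of a f 0 "\<lambda>_. 0" u] by simp

text \<open>The squared norm of \<open>dev_op f\<close> is a polynomial in the values of
  \<open>f\<close> on \<open>V\<close>, so it attains a maximum on the unit sphere; homogeneity
  extends the bound to all \<open>f\<close>.\<close>

lemma dev_op_attains_norm:
  obtains f\<^sub>0 \<sigma> where "0 \<le> \<sigma>" "(\<Sum>v\<in>V. (f\<^sub>0 v)\<^sup>2) = 1"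
    "(\<Sum>v\<in>V. (dev_op f\<^sub>0 v)\<^sup>2) = \<sigma>\<^sup>2"
    "\<And>f. (\<Sum>v\<in>V. (dev_op f v)\<^sup>2) \<le> \<sigma>\<^sup>2 * (\<Sum>v\<in>V. (f v)\<^sup>2)"
proof -
  define K where "K = {f :: 'v \<Rightarrow> real. \<forall>v. f v \<in> (if v \<in> V then {-1..1} else {0})}"
  define S where "S = K \<inter> {f. (\<Sum>v\<in>V. (f v)\<^sup>2) = 1}"
  \<comment> \<open>Spelled out through the values on \<open>V\<close>, so that continuity in the
    product topology follows from that of the coordinates.\<close>
  define q where "q f = (\<Sum>u\<in>V. (\<Sum>v\<in>V. (real (adj G u v) / real deg - 1 / real N) * f v)\<^sup>2)"
    for f :: "'v \<Rightarrow> real"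
  have q: "q f = (\<Sum>v\<in>V. (dev_op f v)\<^sup>2)" for f
    unfolding q_def by (intro sum.cong) (auto simp: dev_op_adj)
  have "closed {f :: 'v \<Rightarrow> real. (\<Sum>v\<in>V. (f v)\<^sup>2) = 1}"
    by (intro closed_Collect_eq continuous_intros continuous_on_product_coordinates)
  then have "compact S"
    unfolding S_def K_def by (intro compact_Int_closed compact_functions_on)
  obtain v\<^sub>0 where v\<^sub>0: "v\<^sub>0 \<in> V" using V_ne by blast
  have "(\<lambda>v. if v = v\<^sub>0 then 1 else 0) \<in> S"
    using v\<^sub>0 unfolding S_def K_def by (auto simp: if_distrib[of "\<lambda>x. x\<^sup>2"] cong: if_cong)
  then have "S \<noteq> {}" by blast
  have "continuous_on UNIV q"
    unfolding q_def by (intro continuous_intros continuous_on_product_coordinates)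
  then have "continuous_on S q" by (rule continuous_on_subset) simp
  then obtain f\<^sub>0 where f\<^sub>0: "f\<^sub>0 \<in> S" "\<And>f. f \<in> S \<Longrightarrow> q f \<le> q f\<^sub>0"
    using continuous_attains_sup[OF \<open>compact S\<close> \<open>S \<noteq> {}\<close>] by blast
  have q0: "0 \<le> q f\<^sub>0" unfolding q by (intro sum_nonneg) auto
  show thesis
  proof (rule that[of "sqrt (q f\<^sub>0)" f\<^sub>0])
    show "0 \<le> sqrt (q f\<^sub>0)" using q0 by simp
    show "(\<Sum>v\<in>V. (f\<^sub>0 v)\<^sup>2) = 1" using f\<^sub>0(1) by (simp add: S_def)
    show "(\<Sum>v\<in>V. (dev_op f\<^sub>0 v)\<^sup>2) = (sqrt (q f\<^sub>0))\<^sup>2" using q0 by (simp add: q)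
    fix f :: "'v \<Rightarrow> real"
    define n where "n = (\<Sum>v\<in>V. (f v)\<^sup>2)"
    have n: "0 \<le> n" unfolding n_def by (intro sum_nonneg) auto
    have "q f \<le> q f\<^sub>0 * n"
    proof (cases "n = 0")
      case True
      then have "\<forall>v\<in>V. f v = 0" unfolding n_def by (simp add: sum_nonneg_eq_0_iff)
      then have "q f = 0" unfolding q_def by simp
      then show ?thesis using True by simp
    next
      case False
      \<comment> \<open>Normalised, and cut off outside \<open>V\<close> so as to lie in
        \<open>S\<close>.\<close>
      define g where "g v = (if v \<in> V then 1 / sqrt n * f v else 0)" for v
      have g1: "(\<Sum>v\<in>V. (g v)\<^sup>2) = 1"
        using False n by (simp add: g_def power_mult_distrib power_divide n_def flip: sum_divide_distrib)
      have "(g v)\<^sup>2 \<le> 1" if "v \<in> V" for v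
        unfolding g1[symmetric] using that by (intro member_le_sum) auto
      then have "\<bar>g v\<bar> \<le> 1" if "v \<in> V" for v
        using that unfolding abs_square_le_1 by blast
      then have "- 1 \<le> g v" "g v \<le> 1" if "v \<in> V" for v
        using that by (simp_all add: abs_le_iff minus_le_iff)
      moreover have "g v = 0" if "v \<notin> V" for v using that by (simp add: g_def)
      ultimately have "g \<in> S" using g1 by (auto simp: S_def K_def)
      have "q f = (\<Sum>v\<in>V. (dev_op (\<lambda>v. sqrt n * g v) v)\<^sup>2)"
        unfolding q using False n by (intro sum.cong refl arg_cong[of _ _ "\<lambda>x. x\<^sup>2"] dev_op_cong) (auto simp: g_def)
      also have "\<dots> = n * q g"
        using n by (simp add: dev_op_scale q power_mult_distrib sum_distrib_left)
      also have "\<dots> \<le> q f\<^sub>0 * n" using f\<^sub>0(2)[OF \<open>g \<in> S\<close>] n by (simp add: mult.commute mult_left_mono)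
      finally show ?thesis .
    qed
    then show "(\<Sum>v\<in>V. (dev_op f v)\<^sup>2) \<le> (sqrt (q f\<^sub>0))\<^sup>2 * (\<Sum>v\<in>V. (f v)\<^sup>2)"
      using q0 by (simp add: q n_def)
  qed
qed

text \<open>Let \<open>A\<close> stand for \<open>dev_op\<close>. A maximiser of the norm is an
  eigenfunction of \<open>A\<^sup>2\<close> for \<open>\<sigma>\<^sup>2\<close>, and from it one
  gets an eigenfunction of \<open>A\<close> for \<sigma> or for -\<sigma>.\<close>

lemma dev_op_norm_eigenvalue:
  obtains r where "r \<in># proots (char_poly dev_mat)"
    "\<And>f. (\<Sum>v\<in>V. (dev_op f v)\<^sup>2) \<le> r\<^sup>2 * (\<Sum>v\<in>V. (f v)\<^sup>2)"
proof -
  obtain f \<sigma> where \<sigma>: "0 \<le> \<sigma>" and f1: "(\<Sum>v\<in>V. (f v)\<^sup>2) = 1"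
    and fs: "(\<Sum>v\<in>V. (dev_op f v)\<^sup>2) = \<sigma>\<^sup>2"
    and bound: "\<And>f. (\<Sum>v\<in>V. (dev_op f v)\<^sup>2) \<le> \<sigma>\<^sup>2 * (\<Sum>v\<in>V. (f v)\<^sup>2)"
    by (rule dev_op_attains_norm) blast
  define Af where "Af = dev_op f"
  \<comment> \<open>The form \<open>\<sigma>\<^sup>2\<langle>f, g\<rangle> - \<langle>Af, Ag\<rangle>\<close> is positive semidefinite and vanishes at \<open>(f, f)\<close>,
    so it vanishes at all \<open>(f, g)\<close>.\<close>
  have orth: "(\<Sum>v\<in>V. (\<sigma>\<^sup>2 * f v - dev_op Af v) * g v) = 0" for g
  proof (rule linear_coeff_eq_0)
    let ?c = "\<sigma>\<^sup>2 * (\<Sum>v\<in>V. (g v)\<^sup>2) - (\<Sum>v\<in>V. (dev_op g v)\<^sup>2)"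
    show "0 \<le> ?c" using bound[of g] by simp
    fix t :: real
    have exp: "(\<Sum>v\<in>V. (p v + t * r v)\<^sup>2) =
        (\<Sum>v\<in>V. (p v)\<^sup>2) + 2 * t * (\<Sum>v\<in>V. p v * r v) + t\<^sup>2 * (\<Sum>v\<in>V. (r v)\<^sup>2)" for p r :: "'v \<Rightarrow> real"
      by (simp add: power2_sum power_mult_distrib sum.distrib sum_distrib_left mult_ac)
    have "(\<Sum>v\<in>V. (Af v + t * dev_op g v)\<^sup>2) \<le> \<sigma>\<^sup>2 * (\<Sum>v\<in>V. (f v + t * g v)\<^sup>2)"
      using bound[of "\<lambda>v. 1 * f v + t * g v"] unfolding dev_op_linear by (simp add: Af_def)
    then have "0 \<le> 2 * t * (\<sigma>\<^sup>2 * (\<Sum>v\<in>V. f v * g v) - (\<Sum>v\<in>V. Af v * dev_op g v)) + t\<^sup>2 * ?c"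
      unfolding exp using f1 fs unfolding Af_def by (simp add: algebra_simps)
    also have "(\<Sum>v\<in>V. Af v * dev_op g v) = (\<Sum>v\<in>V. dev_op Af v * g v)"
      by (rule dev_op_symmetric[symmetric])
    also have "\<sigma>\<^sup>2 * (\<Sum>v\<in>V. f v * g v) - (\<Sum>v\<in>V. dev_op Af v * g v) =
        (\<Sum>v\<in>V. (\<sigma>\<^sup>2 * f v - dev_op Af v) * g v)"
      by (simp add: left_diff_distrib sum_subtractf sum_distrib_left mult.assoc)
    finally show "0 \<le> 2 * t * (\<Sum>v\<in>V. (\<sigma>\<^sup>2 * f v - dev_op Af v) * g v) + t\<^sup>2 * ?c" .
  qed
  have "(\<Sum>v\<in>V. (\<sigma>\<^sup>2 * f v - dev_op Af v)\<^sup>2) = 0"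
    using orth[of "\<lambda>v. \<sigma>\<^sup>2 * f v - dev_op Af v"] by (simp add: power2_eq_square)
  then have AAf: "dev_op Af v = \<sigma>\<^sup>2 * f v" if "v \<in> V" for v
    using that by (simp add: sum_nonneg_eq_0_iff)
  \<comment> \<open>\<open>(A - \<sigma>) (A + \<sigma>) f = 0\<close> on \<open>V\<close>, and
    \<open>w\<close> is \<open>(A + \<sigma>) f\<close>: if it vanishes on \<open>V\<close>, then
    \<open>f\<close> is an eigenfunction for -\<sigma>, and otherwise \<open>w\<close> is one for
    \<sigma>.\<close>
  define w where "w v = Af v + \<sigma> * f v" for v
  show thesis
  proof (cases "\<forall>v\<in>V. w v = 0")
    case True
    have "\<exists>v\<in>V. f v \<noteq> 0"
    proof (rule ccontr)
      assume "\<not> (\<exists>v\<in>V. f v \<noteq> 0)"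
      then have "(\<Sum>v\<in>V. (f v)\<^sup>2) = 0" by simp
      then show False using f1 by simp
    qed
    moreover have "\<forall>v\<in>V. dev_op f v = - \<sigma> * f v"
      using True unfolding w_def Af_def by (auto simp: add_eq_0_iff2)
    ultimately have "- \<sigma> \<in># proots (char_poly dev_mat)"
      unfolding dev_mat_eigen by blast
    then show thesis using bound by (intro that[of "- \<sigma>"]) auto
  next
    case False
    have "dev_op w u = \<sigma> * w u" if "u \<in> V" for u
      using dev_op_linear[of 1 Af \<sigma> f u] AAf[OF that]
      unfolding w_def Af_def[symmetric] by (simp add: power2_eq_square algebra_simps Af_def)
    then have "\<sigma> \<in># proots (char_poly dev_mat)"
      unfolding dev_mat_eigen using False by blast
    then show thesis using bound by (intro that[of \<sigma>]) auto
  qed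
qed

text \<open>The norm of \<open>dev_op\<close> is at most the absolute value of some root
  \<open>r\<close> of its characteristic polynomial. Either \<open>r\<close> is the extra root 0, or
  it lies in \<open>R\<close>; in that case the assumption puts the root 1 in first place, so the
  absolute value of \<open>r\<close> is at most the second entry.\<close>

lemma contracts_second_eigenvalue:
  assumes "second_eigenvalue G < 1"
  shows "contracts G (second_eigenvalue G)"
proof -
  obtain R where R: "proots (char_poly (normalized_adj_mat G)) = add_mset 1 R"
    "proots (char_poly dev_mat) = add_mset 0 R" by (rule proots_char_polys)
  define l where "l = second_eigenvalue G"
  define xs where "xs = rev (sorted_list_of_multiset (add_mset 1 (image_mset abs R)))"
  have mx: "mset xs = add_mset 1 (image_mset abs R)" unfolding xs_def by simp
  have l: "l = (if length xs < 2 then 0 else xs ! 1)"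
    unfolding l_def second_eigenvalue_def R(1) xs_def Let_def by simp
  have len: "length xs = Suc (size R)" using arg_cong[OF mx, of size] by simp
  have "xs ! 1 \<in># add_mset 1 (image_mset abs R)" if "\<not> length xs < 2"
    unfolding mx[symmetric] using that by simp
  then have "0 \<le> l" unfolding l by auto
  obtain r where r: "r \<in># proots (char_poly dev_mat)"
    and bound: "\<And>f. (\<Sum>v\<in>V. (dev_op f v)\<^sup>2) \<le> r\<^sup>2 * (\<Sum>v\<in>V. (f v)\<^sup>2)"
    by (rule dev_op_norm_eigenvalue) blast
  have "\<bar>r\<bar> \<le> l"
  proof (cases "r \<in># R")
    case True
    then have "\<not> length xs < 2" unfolding len by (cases R) auto
    then have "xs ! 1 = l" using l by simp
    then show ?thesis
      using le_second_entry[OF xs_def] assms True unfolding l_def by auto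
  qed (use r R \<open>0 \<le> l\<close> in auto)
  then have "r\<^sup>2 \<le> l\<^sup>2" using abs_le_square_iff[of r l] \<open>0 \<le> l\<close> by simp
  show ?thesis
    unfolding contracts_def l_def[symmetric]
  proof (intro allI impI)
    fix f :: "'v \<Rightarrow> real" assume "(\<Sum>v\<in>V. f v) = 0"
    then have "(\<Sum>v\<in>V. (avg_op G f v)\<^sup>2) = (\<Sum>v\<in>V. (dev_op f v)\<^sup>2)"
      by (simp add: dev_op_def mean_def)
    also have "\<dots> \<le> r\<^sup>2 * (\<Sum>v\<in>V. (f v)\<^sup>2)" by (rule bound)
    also have "\<dots> \<le> l\<^sup>2 * (\<Sum>v\<in>V. (f v)\<^sup>2)"
      using \<open>r\<^sup>2 \<le> l\<^sup>2\<close> by (intro mult_right_mono sum_nonneg) auto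
    finally show "(\<Sum>v\<in>V. (avg_op G f v)\<^sup>2) \<le> l\<^sup>2 * (\<Sum>v\<in>V. (f v)\<^sup>2)" .
  qed
qed

end

section \<open>The zig-zag product\<close>

text \<open>Averaging preserves the mean and contracts the mean-free part, and these two parts are
  orthogonal.\<close>

lemma (in regular_graph) contracts_sum_squares:
  assumes c: "contracts G c"
  shows "(\<Sum>v\<in>V. (avg_op G f v)\<^sup>2) \<le> c\<^sup>2 * (\<Sum>v\<in>V. (f v)\<^sup>2) + (1 - c\<^sup>2) * (real N * (mean f)\<^sup>2)"
proof -
  have "mean (avg_op G f) = mean f" by (simp add: mean_def sum_avg_op)
  moreover have "avg_op G f v - mean f = avg_op G (\<lambda>v. f v - mean f) v" for v
    using dev_op_eq[of f v] by (simp add: dev_op_def)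
  ultimately have "(\<Sum>v\<in>V. (avg_op G f v)\<^sup>2) =
      real N * (mean f)\<^sup>2 + (\<Sum>v\<in>V. (avg_op G (\<lambda>v. f v - mean f) v)\<^sup>2)"
    by (simp add: sum_square_decomp[of "avg_op G f"])
  also have "\<dots> \<le> real N * (mean f)\<^sup>2 + c\<^sup>2 * (\<Sum>v\<in>V. (f v - mean f)\<^sup>2)"
    using c sum_mean unfolding contracts_def by (intro add_left_mono) blast
  also have "(\<Sum>v\<in>V. (f v - mean f)\<^sup>2) = (\<Sum>v\<in>V. (f v)\<^sup>2) - real N * (mean f)\<^sup>2"
    by (simp add: sum_square_decomp[of f])
  finally show ?thesis by (simp add: algebra_simps)
qed

section \<open>The walk operator of the zig-zag product\<close>

locale zigzag_product = H: regular_graph H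
  for H :: "('k, 'e) mgraph" +
  fixes V :: "'v set" and rot :: "'v \<times> 'k \<Rightarrow> 'v \<times> 'k"
  assumes rot: "rotation_map V (verts H) rot"
    and V_fin: "finite V" and V_nonempty: "V \<noteq> {}"
begin

abbreviation "K \<equiv> verts H"
abbreviation "E \<equiv> rotation_graph V (verts H) rot"
abbreviation "Z \<equiv> zigzag V rot H"

lemma E_simps [simp]: "verts E = V" "labels E = K" "nbr E v k = fst (rot (v, k))"
  by (auto simp: rotation_graph_def)

lemma Z_simps [simp]: "verts Z = V \<times> K" "labels Z = labels H \<times> labels H"
  by (auto simp: zigzag_def)

lemma rot_in: "p \<in> V \<times> K \<Longrightarrow> rot p \<in> V \<times> K" and rot_rot: "p \<in> V \<times> K \<Longrightarrow> rot (rot p) = p"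
  using rot by (auto simp: rotation_map_def)

lemma bij_rot: "bij_betw rot (V \<times> K) (V \<times> K)"
  by (rule bij_betw_byWitness[of _ rot]) (blast intro: rot_rot rot_in)+

lemma sum_rot: "(\<Sum>p\<in>V \<times> K. f (rot p)) = (\<Sum>p\<in>V \<times> K. f p)"
  by (rule sum.reindex_bij_betw[OF bij_rot])

lemma finVK [simp]: "finite V" "finite (V \<times> K)"
  using V_fin by auto

text \<open>The operator called \<open>B\<close> in the introduction.\<close>

definition lift_op :: "('v \<times> 'k \<Rightarrow> real) \<Rightarrow> 'v \<times> 'k \<Rightarrow> real" where
  "lift_op f p = avg_op H (\<lambda>k. f (fst p, k)) (snd p)"

text \<open>The factorisation \<open>B R B\<close>: the label \<open>a\<close> averages within the
  starting fibre, the label \<open>b\<close> within the fibre reached by \<open>rot\<close>, and the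
  sum over pairs of labels is an iterated sum.\<close>

lemma avg_op_Z:
  assumes "p \<in> V \<times> K"
  shows "avg_op Z f p = lift_op (\<lambda>q. lift_op f (rot q)) p"
proof -
  obtain v k where p: "p = (v, k)" by (cases p)
  have "(\<Sum>e\<in>labels Z. f (nbr Z p e)) = (\<Sum>a\<in>labels H. \<Sum>b\<in>labels H. f (nbr Z p (a, b)))"
    by (simp add: sum.cartesian_product)
  also have "\<dots> = (\<Sum>a\<in>labels H. \<Sum>b\<in>labels H. f (fst (rot (v, nbr H k a)), nbr H (snd (rot (v, nbr H k a))) b))"
    by (simp add: zigzag_def p Let_def case_prod_unfold)
  finally show ?thesis
    unfolding avg_op_def lift_op_def
    by (simp add: p card_cartesian_product flip: sum_divide_distrib)
qed

text \<open>As \<open>rot\<close> is an involution, passing from the label of an edge at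
  \<open>u\<close> to its label at \<open>v\<close> is a bijection from the edges from
  \<open>u\<close> to \<open>v\<close> onto those from \<open>v\<close> to \<open>u\<close>.\<close>

lemma E_regular: "regular_graph E"
proof
  have "adj E u v = adj E v u" if uv: "u \<in> V" "v \<in> V" for u v
  proof -
    have "bij_betw (\<lambda>k. snd (rot (u, k))) {k \<in> K. fst (rot (u, k)) = v} {k \<in> K. fst (rot (v, k)) = u}"
    proof (rule bij_betw_byWitness[of _ "\<lambda>k. snd (rot (v, k))"])
      have *: "rot (x, k) = (y, snd (rot (x, k)))" "rot (y, snd (rot (x, k))) = (x, k)"
          "snd (rot (x, k)) \<in> K"
        if "x \<in> V" "k \<in> K" "fst (rot (x, k)) = y" for x y k
      proof -
        show 1: "rot (x, k) = (y, snd (rot (x, k)))" using that by (metis prod.collapse)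
        show "rot (y, snd (rot (x, k))) = (x, k)" using rot_rot[of "(x, k)"] that 1 by auto
        show "snd (rot (x, k)) \<in> K" using rot_in[of "(x, k)"] that by auto
      qed
      show "\<forall>k\<in>{k \<in> K. fst (rot (u, k)) = v}. snd (rot (v, snd (rot (u, k)))) = k"
        "\<forall>k\<in>{k \<in> K. fst (rot (v, k)) = u}. snd (rot (u, snd (rot (v, k)))) = k"
        "(\<lambda>k. snd (rot (u, k))) ` {k \<in> K. fst (rot (u, k)) = v} \<subseteq> {k \<in> K. fst (rot (v, k)) = u}"
        "(\<lambda>k. snd (rot (v, k))) ` {k \<in> K. fst (rot (v, k)) = u} \<subseteq> {k \<in> K. fst (rot (u, k)) = v}"
        using *[OF uv(1)] *[OF uv(2)] by auto
    qed
    then show ?thesis unfolding adj_def by (simp add: bij_betw_same_card)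
  qed
  then show "regular_mgraph E"
    using rot_in unfolding regular_mgraph_def by (fastforce simp: mem_Times_iff)
qed (use V_nonempty H.V_ne in auto)

lemma sum_VK: "(\<Sum>p\<in>V \<times> K. f p) = (\<Sum>v\<in>V. \<Sum>k\<in>K. f (v, k))"
  by (simp add: sum.cartesian_product)

lemma lift_op_symmetric:
  "(\<Sum>p\<in>V \<times> K. lift_op f p * g p) = (\<Sum>p\<in>V \<times> K. f p * lift_op g p)"
  unfolding sum_VK lift_op_def using H.avg_op_symmetric by simp

text \<open>\<open>B\<close> is symmetric because \<open>H\<close> is undirected, and
  \<open>R\<close> because \<open>rot\<close> is an involution; hence so is
  \<open>B R B\<close>.\<close>

lemma avg_op_Z_symmetric:
  "(\<Sum>p\<in>V \<times> K. avg_op Z f p * g p) = (\<Sum>p\<in>V \<times> K. f p * avg_op Z g p)"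
proof -
  have "(\<Sum>p\<in>V \<times> K. avg_op Z f p * g p) = (\<Sum>p\<in>V \<times> K. lift_op f (rot p) * lift_op g p)"
    by (simp add: avg_op_Z lift_op_symmetric)
  also have "\<dots> = (\<Sum>p\<in>V \<times> K. lift_op f (rot (rot p)) * lift_op g (rot p))"
    by (rule sum_rot[symmetric])
  also have "\<dots> = (\<Sum>p\<in>V \<times> K. lift_op f p * lift_op g (rot p))"
    by (intro sum.cong) (auto simp: rot_rot)
  also have "\<dots> = (\<Sum>p\<in>V \<times> K. f p * avg_op Z g p)"
    by (simp add: avg_op_Z lift_op_symmetric)
  finally show ?thesis .
qed

lemma nbr_Z_in:
  assumes "p \<in> V \<times> K" "e \<in> labels Z"
  shows "nbr Z p e \<in> V \<times> K"
proof -
  obtain v k a b where p: "p = (v, k)" "e = (a, b)" by (cases p; cases e)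
  have "rot (v, nbr H k a) \<in> V \<times> K" using assms p by (intro rot_in) auto
  then show ?thesis using assms p by (auto simp: zigzag_def Let_def split: prod.splits)
qed

lemma Z_regular: "regular_graph Z"
proof
  have "adj Z p q = adj Z q p" if pq: "p \<in> V \<times> K" "q \<in> V \<times> K" for p q
  proof -
    \<comment> \<open>Testing the symmetry of the operator on indicators of single vertices recovers
      that of the edge counts.\<close>
    have adj: "avg_op Z (\<lambda>y. if y = x then 1 else 0) w = real (adj Z w x) / real (card (labels Z))" for x w
      unfolding avg_op_def adj_def by (simp add: sum.If_cases Int_def)
    have delta: "(\<Sum>r\<in>V \<times> K. f r * (if r = x then 1 else 0)) = f x" if "x \<in> V \<times> K" for x and f :: "_ \<Rightarrow> real"
      using that by (simp add: if_distrib[of "\<lambda>y. _ * y"] cong: if_cong)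
    have "(\<Sum>r\<in>V \<times> K. avg_op Z (\<lambda>y. if y = q then 1 else 0) r * (if r = p then 1 else 0)) =
      (\<Sum>r\<in>V \<times> K. avg_op Z (\<lambda>y. if y = p then 1 else 0) r * (if r = q then 1 else 0))"
      by (subst avg_op_Z_symmetric) (simp add: mult.commute)
    then show ?thesis unfolding delta[OF pq(1)] delta[OF pq(2)] adj using H.L_ne by simp
  qed
  then show "regular_mgraph Z"
    using nbr_Z_in unfolding regular_mgraph_def by auto
qed (use V_nonempty H.V_ne H.L_ne in auto)

section \<open>Fibre means and the contraction bound\<close>

definition fibre_mean :: "('v \<times> 'k \<Rightarrow> real) \<Rightarrow> 'v \<Rightarrow> real" where
  "fibre_mean f v = H.mean (\<lambda>k. f (v, k))"

abbreviation "n \<equiv> real (card K)"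

lemma n_pos: "n > 0" using H.N_pos by simp

lemma sum_fibre_mean: "n * (\<Sum>v\<in>V. fibre_mean f v) = (\<Sum>p\<in>V \<times> K. f p)"
  using n_pos by (simp add: fibre_mean_def H.mean_def sum_VK flip: sum_divide_distrib)

lemma sum_squares_fibre:
  "(\<Sum>p\<in>V \<times> K. (f p)\<^sup>2) =
     n * (\<Sum>v\<in>V. (fibre_mean f v)\<^sup>2) + (\<Sum>p\<in>V \<times> K. (f p - fibre_mean f (fst p))\<^sup>2)"
proof -
  have "(\<Sum>k\<in>K. (f (v, k))\<^sup>2) = n * (fibre_mean f v)\<^sup>2 + (\<Sum>k\<in>K. (f (v, k) - fibre_mean f v)\<^sup>2)" for v
    using H.sum_square_decomp[of "\<lambda>k. f (v, k)"] by (simp add: fibre_mean_def)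
  then show ?thesis by (simp add: sum_VK sum.distrib sum_distrib_left)
qed

lemma fibre_mean_le: "n * (\<Sum>v\<in>V. (fibre_mean f v)\<^sup>2) \<le> (\<Sum>p\<in>V \<times> K. (f p)\<^sup>2)"
  unfolding sum_squares_fibre[of f] by (simp add: sum_nonneg)

lemma lift_op_contracts:
  assumes "contracts H h"
  shows "(\<Sum>p\<in>V \<times> K. (lift_op f p)\<^sup>2) \<le>
    h\<^sup>2 * (\<Sum>p\<in>V \<times> K. (f p)\<^sup>2) + (1 - h\<^sup>2) * (n * (\<Sum>v\<in>V. (fibre_mean f v)\<^sup>2))"
proof -
  have "(\<Sum>k\<in>K. (lift_op f (v, k))\<^sup>2) \<le>
      h\<^sup>2 * (\<Sum>k\<in>K. (f (v, k))\<^sup>2) + (1 - h\<^sup>2) * (n * (fibre_mean f v)\<^sup>2)" for v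
    using H.contracts_sum_squares[OF assms, of "\<lambda>k. f (v, k)"] by (simp add: lift_op_def fibre_mean_def)
  then have "(\<Sum>v\<in>V. \<Sum>k\<in>K. (lift_op f (v, k))\<^sup>2) \<le>
      (\<Sum>v\<in>V. h\<^sup>2 * (\<Sum>k\<in>K. (f (v, k))\<^sup>2) + (1 - h\<^sup>2) * (n * (fibre_mean f v)\<^sup>2))"
    by (rule sum_mono)
  then show ?thesis by (simp add: sum_VK sum.distrib sum_distrib_left)
qed

end

text \<open>Minkowski's inequality in squared form.\<close>

lemma sum_squares_triangle:
  fixes f g :: "'a \<Rightarrow> real"
  assumes "(\<Sum>x\<in>A. (f x)\<^sup>2) \<le> a\<^sup>2" "(\<Sum>x\<in>A. (g x)\<^sup>2) \<le> b\<^sup>2" "0 \<le> a" "0 \<le> b"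
  shows "(\<Sum>x\<in>A. (f x + g x)\<^sup>2) \<le> (a + b)\<^sup>2"
proof -
  have "L2_set f A \<le> a" "L2_set g A \<le> b"
    using assms by (auto simp: L2_set_def intro: real_le_lsqrt sum_nonneg)
  then have "L2_set (\<lambda>x. f x + g x) A \<le> a + b"
    using L2_set_triangle_ineq[of f g A] by linarith
  then show ?thesis
    unfolding L2_set_def using sqrt_le_D by blast
qed

text \<open>The last \<open>B\<close> contracts by \<open>h\<close> except on the fibre means of
  \<open>R B x\<close>. These are small for two reasons: what stems from the fibre means of
  \<open>x\<close> has been averaged over \<open>E\<close>, and the rest has been contracted by the
  first \<open>B\<close>.\<close>

lemma (in zigzag_product) zigzag_contracts:
  assumes E: "contracts E e" and H: "contracts H h" and e: "0 \<le> e" and h: "0 \<le> h" "h \<le> 1"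
  shows "contracts Z (sqrt (h\<^sup>2 + (1 - h\<^sup>2) * (e\<^sup>2 + h\<^sup>2)))"
  unfolding contracts_def
proof (intro allI impI)
  fix x :: "'v \<times> 'k \<Rightarrow> real" assume x0: "(\<Sum>p\<in>verts Z. x p) = 0"
  have h2: "0 \<le> 1 - h\<^sup>2" using h by (simp add: abs_square_le_1)
  define X where "X = (\<Sum>p\<in>V \<times> K. (x p)\<^sup>2)"
  \<comment> \<open>\<open>y\<close> is \<open>B x\<close> and \<open>z\<close> is
    \<open>R B x\<close>; since \<open>B\<close> preserves the fibre means \<open>p\<close>, the
    function \<open>q\<close> is the part of \<open>B x\<close> with mean zero in each
    fibre.\<close>
  define y where "y = lift_op x"
  define z where "z q = y (rot q)" for q
  define p where "p = fibre_mean x"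
  define q where "q r = y r - p (fst r)" for r
  define A where "A = (\<Sum>v\<in>V. (p v)\<^sup>2)"
  have A0: "0 \<le> A" unfolding A_def by (intro sum_nonneg) auto
  have nA: "n * A \<le> X" unfolding A_def p_def X_def by (rule fibre_mean_le)
  have sz: "(\<Sum>r\<in>V \<times> K. (z r)\<^sup>2) \<le> X"
  proof -
    have "(\<Sum>r\<in>V \<times> K. (z r)\<^sup>2) = (\<Sum>r\<in>V \<times> K. (y r)\<^sup>2)"
      unfolding z_def by (rule sum_rot)
    also have "\<dots> \<le> h\<^sup>2 * X + (1 - h\<^sup>2) * (n * A)"
      unfolding y_def X_def A_def p_def by (rule lift_op_contracts[OF H])
    also have "\<dots> \<le> h\<^sup>2 * X + (1 - h\<^sup>2) * X"
      using h2 nA by (intro add_left_mono mult_left_mono)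
    finally show ?thesis by (simp add: algebra_simps)
  qed
  have "(\<Sum>v\<in>V. p v) = 0"
    using sum_fibre_mean[of x] x0 H.V_ne by (simp add: p_def)
  then have sE: "(\<Sum>v\<in>V. (avg_op E p v)\<^sup>2) \<le> (e * sqrt A)\<^sup>2"
    using E A0 unfolding contracts_def by (simp add: A_def power_mult_distrib)
  have sq: "(\<Sum>r\<in>V \<times> K. (q r)\<^sup>2) \<le> h\<^sup>2 * (X - n * A)"
  proof -
    have "q (v, k) = avg_op H (\<lambda>k. x (v, k) - p v) k" for v k
      using H.dev_op_eq[of "\<lambda>k. x (v, k)" k] by (simp add: q_def y_def lift_op_def p_def fibre_mean_def H.dev_op_def)
    moreover have "(\<Sum>k\<in>K. x (v, k) - p v) = 0" for v
      unfolding p_def fibre_mean_def by (rule H.sum_mean)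
    ultimately have "(\<Sum>k\<in>K. (q (v, k))\<^sup>2) \<le> h\<^sup>2 * (\<Sum>k\<in>K. (x (v, k) - p v)\<^sup>2)" for v
      using H unfolding contracts_def by simp
    then have "(\<Sum>v\<in>V. \<Sum>k\<in>K. (q (v, k))\<^sup>2) \<le> (\<Sum>v\<in>V. h\<^sup>2 * (\<Sum>k\<in>K. (x (v, k) - p v)\<^sup>2))"
      by (rule sum_mono)
    then have "(\<Sum>r\<in>V \<times> K. (q r)\<^sup>2) \<le> h\<^sup>2 * (\<Sum>r\<in>V \<times> K. (x r - p (fst r))\<^sup>2)"
      by (simp add: sum_VK sum_distrib_left)
    also have "(\<Sum>r\<in>V \<times> K. (x r - p (fst r))\<^sup>2) = X - n * A"
      unfolding X_def A_def p_def by (simp add: sum_squares_fibre[of x])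
    finally show ?thesis .
  qed
  \<comment> \<open>\<open>n * B\<close> is the squared norm of the part of \<open>x\<close> with
    mean zero in each fibre; the scaling matches that of \<open>A\<close>, so that
    \<open>n * (A + B) = X\<close>.\<close>
  define B where "B = (X - n * A) / n"
  have B0: "0 \<le> B" using nA n_pos by (simp add: B_def)
  have "n * (\<Sum>v\<in>V. (fibre_mean (\<lambda>r. q (rot r)) v)\<^sup>2) \<le> (\<Sum>r\<in>V \<times> K. (q (rot r))\<^sup>2)"
    by (rule fibre_mean_le)
  also have "\<dots> = (\<Sum>r\<in>V \<times> K. (q r)\<^sup>2)" by (rule sum_rot)
  also have "\<dots> \<le> h\<^sup>2 * (X - n * A)" by (rule sq)
  finally have sF: "(\<Sum>v\<in>V. (fibre_mean (\<lambda>r. q (rot r)) v)\<^sup>2) \<le> (h * sqrt B)\<^sup>2"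
    using n_pos B0 by (simp add: B_def field_simps power_mult_distrib)
  \<comment> \<open>A function constant on fibres is carried by \<open>rot\<close> to its values at
    the neighbours in \<open>E\<close>; averaging them over the labels at \<open>v\<close> is one
    step on \<open>E\<close>.\<close>
  have fz: "fibre_mean z v = avg_op E p v + fibre_mean (\<lambda>r. q (rot r)) v" for v
    by (simp add: fibre_mean_def H.mean_def avg_op_def z_def q_def sum_subtractf diff_divide_distrib)
  have "(\<Sum>v\<in>V. (fibre_mean z v)\<^sup>2) \<le> (e * sqrt A + h * sqrt B)\<^sup>2"
    unfolding fz using sE sF e h A0 B0 by (intro sum_squares_triangle) auto
  also have "\<dots> \<le> (e\<^sup>2 + h\<^sup>2) * (A + B)"
  proof -
    \<comment> \<open>Cauchy-Schwarz in the plane.\<close>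
    have "(e * x + h * y)\<^sup>2 \<le> (e\<^sup>2 + h\<^sup>2) * (x\<^sup>2 + y\<^sup>2)" for x y :: real
      using zero_le_power2[of "e * y - h * x"] by (simp add: algebra_simps power2_eq_square)
    from this[of "sqrt A" "sqrt B"] show ?thesis using A0 B0 by simp
  qed
  also have "A + B = X / n"
    using n_pos H.V_ne by (simp add: B_def diff_divide_distrib)
  finally have fzb: "n * (\<Sum>v\<in>V. (fibre_mean z v)\<^sup>2) \<le> (e\<^sup>2 + h\<^sup>2) * X"
    using n_pos H.V_ne by (simp add: field_simps)
  have "(\<Sum>r\<in>V \<times> K. (avg_op Z x r)\<^sup>2) = (\<Sum>r\<in>V \<times> K. (lift_op z r)\<^sup>2)"
    unfolding z_def y_def by (intro sum.cong) (auto simp: avg_op_Z)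
  also have "\<dots> \<le> h\<^sup>2 * (\<Sum>r\<in>V \<times> K. (z r)\<^sup>2) + (1 - h\<^sup>2) * (n * (\<Sum>v\<in>V. (fibre_mean z v)\<^sup>2))"
    by (rule lift_op_contracts[OF H])
  also have "\<dots> \<le> h\<^sup>2 * X + (1 - h\<^sup>2) * ((e\<^sup>2 + h\<^sup>2) * X)"
    using sz fzb h2 by (intro add_mono mult_left_mono) auto
  also have "\<dots> = (sqrt (h\<^sup>2 + (1 - h\<^sup>2) * (e\<^sup>2 + h\<^sup>2)))\<^sup>2 * X"
    using h2 by (subst real_sqrt_pow2) (auto simp: distrib_right)
  finally show "(\<Sum>r\<in>verts Z. (avg_op Z x r)\<^sup>2) \<le>
      (sqrt (h\<^sup>2 + (1 - h\<^sup>2) * (e\<^sup>2 + h\<^sup>2)))\<^sup>2 * (\<Sum>r\<in>verts Z. (x r)\<^sup>2)"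
    by (simp add: X_def)
qed

section \<open>Mixing of the walk and of the retained points\<close>

lemma tv_dist_le:
  assumes "\<And>A. \<bar>measure_pmf.prob p A - measure_pmf.prob q A\<bar> \<le> \<epsilon>"
  shows "tv_dist p q \<le> \<epsilon>"
  unfolding tv_dist_def using assms by (intro cSUP_least) auto

lemma prob_diff_le_sum:
  assumes "finite V" "set_pmf p \<subseteq> V" "set_pmf q \<subseteq> V"
  shows "\<bar>measure_pmf.prob p A - measure_pmf.prob q A\<bar> \<le> (\<Sum>v\<in>V. \<bar>pmf p v - pmf q v\<bar>)"
proof -
  have prob: "measure_pmf.prob r A = (\<Sum>v\<in>A \<inter> V. pmf r v)" if "set_pmf r \<subseteq> V" for r
  proof -
    have "measure_pmf.prob r A = measure_pmf.prob r (A \<inter> V)"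
      using that by (intro measure_pmf.finite_measure_eq_AE) (auto simp: AE_measure_pmf_iff)
    then show ?thesis using assms(1) by (simp add: measure_measure_pmf_finite)
  qed
  have "\<bar>measure_pmf.prob p A - measure_pmf.prob q A\<bar> = \<bar>\<Sum>v\<in>A \<inter> V. pmf p v - pmf q v\<bar>"
    using assms by (simp add: prob sum_subtractf)
  also have "\<dots> \<le> (\<Sum>v\<in>A \<inter> V. \<bar>pmf p v - pmf q v\<bar>)" by (rule sum_abs)
  also have "\<dots> \<le> (\<Sum>v\<in>V. \<bar>pmf p v - pmf q v\<bar>)"
    using assms(1) by (intro sum_mono2) auto
  finally show ?thesis .
qed

section \<open>Convergence of the walk and of its conditioned law\<close>

context regular_graph
begin

lemma set_walk: "u \<in> V \<Longrightarrow> set_pmf (walk G u t) \<subseteq> V"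
  by (induction t) (use L_ne in auto)

text \<open>A step acts on distributions by the transpose of the averaging operator, which is that
  operator itself since the graph is undirected.\<close>

lemma pmf_walk_Suc:
  assumes "u \<in> V" "v \<in> V"
  shows "pmf (walk G u (Suc t)) v = avg_op G (pmf (walk G u t)) v"
proof -
  have step: "pmf (map_pmf (nbr G w) (pmf_of_set (labels G))) v = real (adj G w v) / real deg" for w
    using L_ne by (simp add: pmf_map measure_pmf_of_set adj_def Int_def vimage_def)
  have "pmf (walk G u (Suc t)) v = (\<Sum>w\<in>V. pmf (walk G u t) w * (real (adj G w v) / real deg))"
    unfolding walk.simps pmf_bind step
    using set_walk[OF assms(1)] by (subst integral_measure_pmf[of V]) auto
  also have "\<dots> = avg_op G (pmf (walk G u t)) v"
    using assms by (simp add: avg_op_adj adj_sym mult.commute)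
  finally show ?thesis .
qed

text \<open>The deviation from uniformity has mean zero, and each step averages it. At time 0 its
  norm is at most that of a point mass, which is 1.\<close>

lemma walk_sum_squares:
  assumes "contracts G c" "u \<in> V"
  shows "(\<Sum>v\<in>V. (pmf (walk G u t) v - 1 / real N)\<^sup>2) \<le> (c ^ t)\<^sup>2"
proof (induction t)
  case 0
  have "(\<Sum>v\<in>V. (pmf (walk G u 0) v - 1 / real N)\<^sup>2) \<le> (\<Sum>v\<in>V. (pmf (walk G u 0) v)\<^sup>2)"
  proof -
    have "mean (pmf (walk G u 0)) = 1 / real N"
      using assms(2) by (simp add: mean_def pmf_return indicator_def)
    then show ?thesis
      using sum_square_decomp[of "pmf (walk G u 0)"] by (simp del: walk.simps)
  qed
  also have "\<dots> = (\<Sum>v\<in>V. if v = u then 1 else 0)"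
    by (intro sum.cong) (auto simp: pmf_return)
  also have "\<dots> = 1"
    using assms(2) by simp
  finally show ?case by simp
next
  case (Suc t)
  let ?d = "\<lambda>v. pmf (walk G u t) v - 1 / real N"
  have "(\<Sum>v\<in>V. pmf (walk G u t) v) = 1"
    using assms(2) by (intro sum_pmf_eq_1 set_walk) auto
  then have "(\<Sum>v\<in>V. ?d v) = 0" using N_pos V_ne by (simp add: sum_subtractf)
  moreover have "pmf (walk G u (Suc t)) v - 1 / real N = avg_op G ?d v" if "v \<in> V" for v
    using avg_op_linear[of 1 "pmf (walk G u t)" "-1" "\<lambda>_. 1 / real N" v]
    by (simp add: pmf_walk_Suc[OF assms(2) that] del: walk.simps)
  ultimately have "(\<Sum>v\<in>V. (pmf (walk G u (Suc t)) v - 1 / real N)\<^sup>2) \<le> c\<^sup>2 * (\<Sum>v\<in>V. (?d v)\<^sup>2)"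
    using assms(1) unfolding contracts_def by (simp del: walk.simps)
  also have "\<dots> \<le> c\<^sup>2 * (c ^ t)\<^sup>2" using Suc by (intro mult_left_mono) auto
  finally show ?case by (simp add: power_mult_distrib)
qed

text \<open>Each entry of the deviation is bounded by its Euclidean norm. The resulting factor
  \<open>N\<close> is harmless, since only its logarithm enters the mixing time.\<close>

lemma walk_prob_diff:
  assumes "contracts G c" "0 \<le> c" "u \<in> V"
  shows "\<bar>measure_pmf.prob (walk G u t) A - measure_pmf.prob (pmf_of_set V) A\<bar> \<le> real N * c ^ t"
proof -
  let ?d = "\<lambda>v. \<bar>pmf (walk G u t) v - 1 / real N\<bar>"
  have "\<bar>measure_pmf.prob (walk G u t) A - measure_pmf.prob (pmf_of_set V) A\<bar> \<le>
      (\<Sum>v\<in>V. \<bar>pmf (walk G u t) v - pmf (pmf_of_set V) v\<bar>)"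
    using V_ne assms(3) by (intro prob_diff_le_sum set_walk) auto
  also have "\<dots> = (\<Sum>v\<in>V. ?d v)"
    using V_ne by simp
  also have "\<dots> \<le> (\<Sum>v\<in>V. c ^ t)"
  proof (rule sum_mono)
    fix v assume "v \<in> V"
    then have "(?d v)\<^sup>2 \<le> (\<Sum>v\<in>V. (?d v)\<^sup>2)" by (intro member_le_sum) auto
    also have "\<dots> \<le> (c ^ t)\<^sup>2" using walk_sum_squares[OF assms(1,3)] by simp
    finally show "?d v \<le> c ^ t" using assms(2) by (simp add: abs_le_square_iff[symmetric])
  qed
  finally show ?thesis by simp
qed

lemma walk_mixing:
  assumes "contracts G c" "0 < c" "c < 1" "u \<in> V" "0 < \<epsilon>"
    and t: "real t \<ge> 1 / ln (1 / c) * (ln (real N) + ln (1 / \<epsilon>))"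
  shows "\<bar>measure_pmf.prob (walk G u t) A - measure_pmf.prob (pmf_of_set V) A\<bar> \<le> \<epsilon>"
proof -
  have "ln (1 / c) > 0" using assms by simp
  then have "real t * ln (1 / c) \<ge> ln (real N) + ln (1 / \<epsilon>)"
    using t by (simp add: field_simps)
  then have "ln (real N) + real t * ln c \<le> ln \<epsilon>"
    using assms by (simp add: ln_div)
  then have "ln (real N * c ^ t) \<le> ln \<epsilon>"
    using assms N_pos V_ne by (simp add: ln_mult ln_realpow)
  then have "real N * c ^ t \<le> \<epsilon>"
    using assms N_pos V_ne by (subst (asm) ln_le_cancel_iff) auto
  then show ?thesis using walk_prob_diff[of c u t A] assms by simp
qed

text \<open>Both probabilities are quotients by the probability of being retained. Numerators and
  denominators each change by at most \<open>\<epsilon> * \<rho> / 2\<close>, and the uniform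
  denominator is at least \<rho>.\<close>

lemma retained_prob_diff:
  assumes u: "u \<in> V" and inj: "inj_on pt V" and X: "X \<subseteq> pt ` V" "X \<noteq> {}"
    and \<rho>: "0 < \<rho>" "\<rho> * real N \<le> real (card X)" and \<epsilon>: "0 < \<epsilon>" "\<epsilon> < 1"
    and close: "\<And>A. \<bar>measure_pmf.prob (walk G u t) A - measure_pmf.prob (pmf_of_set V) A\<bar> \<le> \<epsilon> * \<rho> / 2"
  shows "\<bar>measure_pmf.prob (retained_law G pt X u t) A - measure_pmf.prob (pmf_of_set X) A\<bar> \<le> \<epsilon>"
proof -
  define R where "R = {v \<in> V. pt v \<in> X}"
  define p where "p = measure_pmf.prob (walk G u t)"
  define q where "q = measure_pmf.prob (pmf_of_set V)"
  define B where "B = pt -` A"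
  have injR: "inj_on pt R" using inj by (rule inj_on_subset) (auto simp: R_def)
  have XR: "X = pt ` R" using X by (auto simp: R_def)
  have q: "q C = real (card (V \<inter> C)) / real N" for C
    unfolding q_def using V_ne by (simp add: measure_pmf_of_set)
  have "V \<inter> R = R" by (auto simp: R_def)
  then have qR: "q R = real (card X) / real N"
    unfolding q XR using injR by (simp add: card_image)
  then have "\<rho> \<le> q R" using \<rho> N_pos by (simp add: field_simps)
  moreover have close': "\<bar>p C - q C\<bar> \<le> \<epsilon> * \<rho> / 2" for C
    using close unfolding p_def q_def by blast
  moreover have "\<epsilon> * \<rho> / 2 < \<rho>" using \<epsilon> \<rho> by simp
  \<comment> \<open>Positivity makes \<open>cond_pmf\<close> a genuine conditional law.\<close>
  ultimately have pR: "0 < p R" using close'[of R] by linarith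
  have qR0: "0 < q R" using \<open>\<rho> \<le> q R\<close> \<rho> by linarith
  have "set_pmf (walk G u t) \<inter> R \<noteq> {}"
    using pR unfolding p_def by (auto simp: measure_pmf_zero_iff[symmetric])
  moreover have "emeasure (measure_pmf (walk G u t)) R \<noteq> 0"
    using pR by (simp add: measure_pmf.emeasure_eq_measure p_def)
  ultimately have "measure_pmf.prob (cond_pmf (walk G u t) R) B = p (R \<inter> B) / p R"
    unfolding p_def by (simp add: cond_pmf.rep_eq)
  then have lhs: "measure_pmf.prob (retained_law G pt X u t) A = p (R \<inter> B) / p R"
    unfolding retained_law_def R_def[symmetric] by (simp add: B_def)
  have "finite X" using X(1) by (rule finite_subset) simp
  have "card (X \<inter> A) = card (R \<inter> B)"
  proof -
    have "X \<inter> A = pt ` (R \<inter> B)" unfolding XR B_def by auto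
    then show ?thesis using inj_on_subset[OF injR] by (simp add: card_image)
  qed
  moreover have "V \<inter> (R \<inter> B) = R \<inter> B" by (auto simp: R_def)
  ultimately have rhs: "measure_pmf.prob (pmf_of_set X) A = q (R \<inter> B) / q R"
    unfolding qR unfolding q using X(2) \<open>finite X\<close> N_pos V_ne by (simp add: measure_pmf_of_set)
  have "p (R \<inter> B) \<le> p R" unfolding p_def by (intro measure_pmf.finite_measure_mono) auto
  then have ratio: "0 \<le> p (R \<inter> B) / p R" "p (R \<inter> B) / p R \<le> 1"
    using pR by (auto simp: p_def)
  \<comment> \<open>In this form the outer denominator is the uniform one, and the walk enters
    otherwise only through differences and a quotient that is at most 1.\<close>
  have "p (R \<inter> B) / p R - q (R \<inter> B) / q R =
      ((p (R \<inter> B) - q (R \<inter> B)) + p (R \<inter> B) / p R * (q R - p R)) / q R"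
    using pR qR0 by (simp add: field_simps)
  also have "\<bar>\<dots>\<bar> \<le> (\<epsilon> * \<rho> / 2 + 1 * (\<epsilon> * \<rho> / 2)) / q R"
    unfolding abs_divide using qR0
  proof (intro frac_le)
    have "\<bar>p (R \<inter> B) / p R * (q R - p R)\<bar> \<le> 1 * (\<epsilon> * \<rho> / 2)"
      unfolding abs_mult using ratio close'[of R] abs_minus_commute[of "q R" "p R"]
      by (intro mult_mono) auto
    then show "\<bar>p (R \<inter> B) - q (R \<inter> B) + p (R \<inter> B) / p R * (q R - p R)\<bar> \<le>
        \<epsilon> * \<rho> / 2 + 1 * (\<epsilon> * \<rho> / 2)"
      using close'[of "R \<inter> B"] by linarith
  qed (use \<epsilon> \<rho> in auto)
  also have "\<dots> \<le> \<epsilon>" using \<open>\<rho> \<le> q R\<close> qR0 \<epsilon> by (simp add: field_simps)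
  finally show ?thesis unfolding lhs rhs .
qed

end

lemma rapidly_mixing_walk:
  assumes c: "0 < c" "c < 1"
    and ev: "\<forall>\<^sub>F m in sequentially. regular_graph (G m) \<and> contracts (G m) c"
  shows "rapidly_mixing G (\<lambda>m. walk (G m)) (\<lambda>m. pmf_of_set (verts (G m)))"
  unfolding rapidly_mixing_def
  by (rule exI[of _ "1 / ln (1 / c)"], rule eventually_mono[OF ev])
    (use c in \<open>auto intro!: tv_dist_le regular_graph.walk_mixing\<close>)

lemma rapidly_mixing_retained:
  assumes c: "0 < c" "c < 1" and \<rho>: "0 < \<rho>"
    and ev: "\<forall>\<^sub>F m in sequentially. regular_graph (G m) \<and> contracts (G m) c"
    and ev': "\<forall>\<^sub>F m in sequentially. inj_on (pt m) (verts (G m)) \<and> X m \<subseteq> pt m ` verts (G m) \<and>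
      X m \<noteq> {} \<and> 2 \<le> card (verts (G m)) \<and> \<rho> * real (card (verts (G m))) \<le> real (card (X m))"
  shows "rapidly_mixing G (\<lambda>m. retained_law (G m) (pt m) (X m)) (\<lambda>m. pmf_of_set (X m))"
proof -
  \<comment> \<open>\<open>L\<close> bounds the extra logarithm for the accuracy
    \<open>\<epsilon> * \<rho> / 2\<close>. With at least two vertices the sum of logarithms is at
    least \<open>ln 2\<close>, so \<open>L\<close> is absorbed as the multiple
    \<open>L / ln 2\<close> of it.\<close>
  define L where "L = max 0 (ln (2 / \<rho>))"
  define C where "C = 1 / ln (1 / c) * (1 + L / ln 2)"
  have c': "0 < ln (1 / c)" using c by simp
  show ?thesis
    unfolding rapidly_mixing_def
  proof (rule exI[of _ C], use ev ev' in eventually_elim, intro ballI allI impI)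
    fix m u \<epsilon> t
    assume G: "regular_graph (G m) \<and> contracts (G m) c"
      and X: "inj_on (pt m) (verts (G m)) \<and> X m \<subseteq> pt m ` verts (G m) \<and>
        X m \<noteq> {} \<and> 2 \<le> card (verts (G m)) \<and> \<rho> * real (card (verts (G m))) \<le> real (card (X m))"
      and u: "u \<in> verts (G m)" and \<epsilon>: "0 < \<epsilon> \<and> \<epsilon> < (1::real)"
      and t: "real t \<ge> C * (ln (real (card (verts (G m)))) + ln (1 / \<epsilon>))"
    interpret regular_graph "G m" using G by blast
    define M where "M = ln (real N) + ln (1 / \<epsilon>)"
    have "ln 2 \<le> ln (real N)" using X by simp
    moreover have "0 \<le> ln (1 / \<epsilon>)" using \<epsilon> by simp
    ultimately have "ln 2 \<le> M" unfolding M_def by linarith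
    have "M + ln (2 / \<rho>) \<le> M + L" by (simp add: L_def)
    also have "\<dots> \<le> M + L / ln 2 * M"
      using mult_left_mono[OF \<open>ln 2 \<le> M\<close>, of "L / ln 2"] by (simp add: L_def)
    finally have "1 / ln (1 / c) * (M + ln (2 / \<rho>)) \<le> 1 / ln (1 / c) * (M + L / ln 2 * M)"
      using c' by (intro mult_left_mono) auto
    also have "\<dots> = C * M" by (simp add: C_def algebra_simps add_divide_distrib)
    also have "\<dots> \<le> real t" using t by (simp add: M_def)
    also have "M + ln (2 / \<rho>) = ln (real N) + ln (1 / (\<epsilon> * \<rho> / 2))"
      using \<epsilon> \<rho> by (simp add: M_def ln_div ln_mult)
    finally have "\<bar>measure_pmf.prob (walk (G m) u t) A - measure_pmf.prob (pmf_of_set V) A\<bar> \<le> \<epsilon> * \<rho> / 2" for A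
      using c \<epsilon> \<rho> u G by (intro walk_mixing[of c]) auto
    then show "tv_dist (retained_law (G m) (pt m) (X m) u t) (pmf_of_set (X m)) \<le> \<epsilon>"
      using X \<epsilon> \<rho> u by (intro tv_dist_le retained_prob_diff[of u "pt m" "X m" \<rho>]) auto
  qed
qed

section \<open>Lattice points\<close>

lemma card_vec_box:
  fixes A :: "'d::finite \<Rightarrow> 'a set"
  assumes "\<And>i. finite (A i)"
  shows "finite {x :: 'a ^ 'd. \<forall>i. x $ i \<in> A i}"
    and "card {x :: 'a ^ 'd. \<forall>i. x $ i \<in> A i} = (\<Prod>i\<in>UNIV. card (A i))"
proof -
  have eq: "{x :: 'a ^ 'd. \<forall>i. x $ i \<in> A i} = vec_lambda ` PiE UNIV A"
  proof (intro equalityI subsetI)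
    fix x :: "'a ^ 'd" assume "x \<in> {x. \<forall>i. x $ i \<in> A i}"
    then have "($) x \<in> PiE UNIV A" by auto
    moreover have "x = vec_lambda (($) x)" by simp
    ultimately show "x \<in> vec_lambda ` PiE UNIV A" by blast
  qed auto
  have "inj_on vec_lambda (PiE UNIV A)"
    by (rule inj_onI) (metis vec_lambda_inverse UNIV_I)
  then show "card {x :: 'a ^ 'd. \<forall>i. x $ i \<in> A i} = (\<Prod>i\<in>UNIV. card (A i))"
    unfolding eq by (simp add: card_image card_PiE)
  show "finite {x :: 'a ^ 'd. \<forall>i. x $ i \<in> A i}"
    unfolding eq using assms by (intro finite_imageI finite_PiE) auto
qed

lemma E_verts_finite: "finite (E_verts n m :: (nat \<times> (int ^ 'd)) set)"
  and card_E_verts: "card (E_verts n m :: (nat \<times> (int ^ 'd)) set) = n * m ^ CARD('d)"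
proof -
  have eq: "{x :: int ^ 'd. \<forall>i. 0 \<le> x $ i \<and> x $ i < int m} = {x. \<forall>i. x $ i \<in> {0..<int m}}"
    by auto
  show "finite (E_verts n m :: (nat \<times> (int ^ 'd)) set)"
    "card (E_verts n m :: (nat \<times> (int ^ 'd)) set) = n * m ^ CARD('d)"
    using card_vec_box[of "\<lambda>_::'d. {0..<int m}"]
    unfolding E_verts_def eq by (auto simp: card_cartesian_product)
qed

section \<open>Vertices and the points they carry\<close>

lemma vertex_point_component:
  "vertex_point s m ((h, x), z) $ i = s h $ i + of_int (x $ i + int m * z $ i)"
  by (simp add: vertex_point_def of_int_vec_def)

text \<open>Each component of \<open>s h\<close> is a fractional part, which determines
  \<open>h\<close>; division of the integer part by \<open>m\<close> has remainder \<open>x\<close>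
  and quotient \<open>z\<close>.\<close>

lemma inj_on_vertex_point:
  fixes s :: "nat \<Rightarrow> real ^ 'd"
  assumes "m \<ge> 1" and inj: "inj_on s {..<n}"
    and s: "\<And>h i. h < n \<Longrightarrow> 0 \<le> s h $ i \<and> s h $ i < 1"
  shows "inj_on (vertex_point s m) (E_verts n m \<times> K)"
proof (rule inj_onI)
  fix p q assume p: "p \<in> E_verts n m \<times> K" and q: "q \<in> E_verts n m \<times> K"
    and eq: "vertex_point s m p = vertex_point s m q"
  obtain h x z h' x' z' where pq: "p = ((h, x), z)" "q = ((h', x'), z')"
    by (metis prod.collapse)
  have h: "h < n" "h' < n" and x: "\<And>i. 0 \<le> x $ i \<and> x $ i < int m" "\<And>i. 0 \<le> x' $ i \<and> x' $ i < int m"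
    using p q pq by (auto simp: E_verts_def)
  have eqi: "s h $ i + of_int (x $ i + int m * z $ i) = s h' $ i + of_int (x' $ i + int m * z' $ i)" for i
    using arg_cong[OF eq, of "\<lambda>v. v $ i"] unfolding pq vertex_point_component .
  have int_eq: "x $ i + int m * z $ i = x' $ i + int m * z' $ i" for i
  proof -
    have "\<bar>real_of_int ((x $ i + int m * z $ i) - (x' $ i + int m * z' $ i))\<bar> < 1"
      using eqi[of i] s[OF h(1), of i] s[OF h(2), of i] unfolding of_int_diff by linarith
    then show ?thesis by linarith
  qed
  have "s h = s h'" using eqi int_eq by (simp add: Finite_Cartesian_Product.vec_eq_iff)
  then have "h = h'" using inj h by (auto dest: inj_onD)
  have x_eq: "x $ i = x' $ i" for i
    using arg_cong[OF int_eq[of i], of "\<lambda>k. k mod int m"] x[of i] by simp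
  then have "z $ i = z' $ i" for i
    using int_eq[of i] assms(1) by simp
  then show "p = q" using \<open>h = h'\<close> x_eq by (simp add: pq Finite_Cartesian_Product.vec_eq_iff)
qed

lemma norm_le_of_component_le:
  fixes v :: "real ^ 'd"
  assumes "\<And>i. \<bar>v $ i\<bar> \<le> e"
  shows "norm v \<le> sqrt (real CARD('d)) * e"
proof -
  have "0 \<le> e" using assms[of undefined] by linarith
  have "(\<Sum>i\<in>UNIV. (norm (v $ i))\<^sup>2) \<le> (\<Sum>i\<in>(UNIV :: 'd set). e\<^sup>2)"
    using assms \<open>0 \<le> e\<close> by (intro sum_mono) (simp add: abs_le_square_iff[symmetric])
  then have "norm v \<le> sqrt (real CARD('d) * e\<^sup>2)"
    unfolding norm_vec_def L2_set_def by simp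
  then show ?thesis using \<open>0 \<le> e\<close> by (simp add: real_sqrt_mult)
qed

text \<open>Division with remainder by \<open>m\<close> places \<open>w = y / m\<close> in the unit
  cube with lower corner \<open>z\<close>. The centre of that cube is at distance at most half the
  diagonal, \<open>sqrt d / 2\<close>, from \<open>w\<close>, and so satisfies the relaxed
  inequalities.\<close>

lemma sample_points_covered:
  fixes s :: "nat \<Rightarrow> real ^ 'd"
  assumes "m \<ge> 1" and s: "\<And>h i. h < n \<Longrightarrow> 0 \<le> s h $ i \<and> s h $ i < 1"
    and b': "\<And>i. i < r \<Longrightarrow> b' i \<ge> b i + sqrt (real CARD('d) / 2) * norm (a i)"
  shows "sample_points (s ` {..<n}) (polyhedron_of r a b) m \<subseteq>
    vertex_point s m ` (E_verts n m \<times> {z. of_int_vec z + (\<chi> i. 1 / 2) \<in> polyhedron_of r a b'})"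
proof
  fix y assume "y \<in> sample_points (s ` {..<n}) (polyhedron_of r a b) m"
  then obtain h z\<^sub>0 w where h: "h < n" and y: "y = s h + of_int_vec z\<^sub>0" "y = real m *\<^sub>R w"
    and w: "w \<in> polyhedron_of r a b"
    unfolding sample_points_def by blast
  define x where "x = (\<chi> i. z\<^sub>0 $ i mod int m)"
  define z where "z = (\<chi> i. z\<^sub>0 $ i div int m)"
  have xz: "x $ i + int m * z $ i = z\<^sub>0 $ i" for i by (simp add: x_def z_def)
  have x: "0 \<le> x $ i" "x $ i < int m" for i using assms(1) by (auto simp: x_def)
  have "y = vertex_point s m ((h, x), z)"
    by (simp add: Finite_Cartesian_Product.vec_eq_iff vertex_point_component xz y(1) of_int_vec_def)
  moreover have "(h, x) \<in> E_verts n m" using h x by (simp add: E_verts_def)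
  moreover have "of_int_vec z + (\<chi> i. 1 / 2) \<in> polyhedron_of r a b'"
    unfolding polyhedron_of_def
  proof (intro CollectI allI impI)
    fix i assume i: "i < r"
    define v where "v = of_int_vec z + (\<chi> i. 1 / 2) - w"
    have "\<bar>v $ j\<bar> \<le> 1 / 2" for j
    proof -
      have m: "real m > 0" using assms(1) by simp
      have "real m * w $ j = s h $ j + of_int (x $ j + int m * z $ j)"
        unfolding xz using arg_cong[OF y(2)[unfolded y(1)], of "\<lambda>v. v $ j"] by (simp add: of_int_vec_def)
      then have w: "w $ j - of_int (z $ j) = (s h $ j + of_int (x $ j)) / real m"
        using m by (simp add: field_simps)
      \<comment> \<open>Integrality gives \<open>m - 1\<close>, which leaves room for the fractional
        part.\<close>
      have "of_int (x $ j) \<le> real m - 1" using x(2)[of j] by linarith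
      then have "0 \<le> s h $ j + of_int (x $ j)" "s h $ j + of_int (x $ j) \<le> real m"
        using s[OF h, of j] x(1)[of j] by auto
      then have "0 \<le> w $ j - of_int (z $ j)" "w $ j - of_int (z $ j) \<le> 1"
        unfolding w using m by auto
      then have "\<bar>of_int (z $ j) + 1 / 2 - w $ j\<bar> \<le> 1 / 2" by linarith
      then show ?thesis by (simp add: v_def of_int_vec_def)
    qed
    then have "norm v \<le> sqrt (real CARD('d)) * (1 / 2)" by (rule norm_le_of_component_le)
    also have "\<dots> = sqrt (real CARD('d) / 4)" by (simp add: real_sqrt_divide)
    also have "\<dots> \<le> sqrt (real CARD('d) / 2)" by simp
    finally have v: "norm v \<le> sqrt (real CARD('d) / 2)" .
    have "inner (a i) (of_int_vec z + (\<chi> i. 1 / 2)) = inner (a i) w + inner (a i) v"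
      by (simp add: v_def inner_diff_right)
    also have "inner (a i) w \<le> b i" using w i by (simp add: polyhedron_of_def)
    also have "inner (a i) v \<le> norm (a i) * norm v" by (rule norm_cauchy_schwarz)
    also have "\<dots> \<le> norm (a i) * sqrt (real CARD('d) / 2)" using v by (intro mult_left_mono) auto
    finally show "inner (a i) (of_int_vec z + (\<chi> i. 1 / 2)) \<le> b' i"
      using b'[OF i] by (simp add: mult.commute)
  qed
  ultimately show "y \<in> vertex_point s m ` (E_verts n m \<times> {z. of_int_vec z + (\<chi> i. 1 / 2) \<in> polyhedron_of r a b'})"
    by blast
qed

section \<open>The density of relevant vertices\<close>

text \<open>The affine hull is the whole space, so the nonempty relative interior is the interior. A
  ball of radius \<open>e\<close> contains the concentric cube of half side
  \<open>e / sqrt d\<close>.\<close>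

lemma full_dim_polytope_contains_cube:
  fixes P :: "(real ^ 'd) set"
  assumes "polytope P" "aff_dim P = int CARD('d)"
  obtains c \<eta> where "0 < \<eta>" "\<And>y. (\<And>i. \<bar>y $ i - c $ i\<bar> \<le> \<eta>) \<Longrightarrow> y \<in> P"
proof -
  have "convex P" using assms(1) by (rule polytope_imp_convex)
  moreover have "P \<noteq> {}" using assms(2) by auto
  ultimately have "rel_interior P \<noteq> {}" by (simp add: rel_interior_eq_empty)
  moreover have "affine hull P = UNIV"
    using assms(2) aff_dim_eq_full[of P] by simp
  ultimately have "interior P \<noteq> {}" by (simp add: rel_interior_interior)
  then obtain c e where ce: "0 < e" "cball c e \<subseteq> P"
    by (auto simp: mem_interior_cball)
  define \<eta> where "\<eta> = e / sqrt (real CARD('d))"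
  show thesis
  proof (rule that[of \<eta> c])
    show "0 < \<eta>" using ce by (simp add: \<eta>_def)
    fix y assume "\<And>i. \<bar>y $ i - c $ i\<bar> \<le> \<eta>"
    then have "norm (y - c) \<le> sqrt (real CARD('d)) * \<eta>"
      by (intro norm_le_of_component_le) simp
    also have "\<dots> = e" by (simp add: \<eta>_def)
    finally show "y \<in> P" using ce by (auto simp: dist_norm norm_minus_commute)
  qed
qed

lemma card_int_interval_ge:
  assumes "u \<le> v"
  shows "real (card {\<lceil>u\<rceil>..\<lfloor>v\<rfloor>}) \<ge> v - u - (1 :: real)"
proof -
  have "real (card {\<lceil>u\<rceil>..\<lfloor>v\<rfloor>}) \<ge> of_int (\<lfloor>v\<rfloor> - \<lceil>u\<rceil> + 1)" by simp
  then show ?thesis by linarith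
qed

text \<open>Only translates of one \<open>p\<close> are counted: in each coordinate \<open>z\<close>
  ranges over an interval of length \<open>2 * real m * \<eta>\<close>, which holds at least
  \<open>2 * real m * \<eta> - 1\<close> integers, and this is at least
  \<open>real m * \<eta>\<close> by the assumption on \<open>m\<close>.\<close>

lemma card_sample_points_ge:
  fixes P :: "(real ^ 'd) set"
  assumes cube: "\<And>y. (\<And>i. \<bar>y $ i - c $ i\<bar> \<le> \<eta>) \<Longrightarrow> y \<in> P" and "0 < \<eta>"
    and m: "1 \<le> real m * \<eta>" and p: "p \<in> S" and fin: "finite (sample_points S P m)"
  shows "(real m * \<eta>) ^ CARD('d) \<le> real (card (sample_points S P m))"
proof -
  have m0: "0 < real m" using m \<open>0 < \<eta>\<close> by (cases m) auto
  define A where "A i = {\<lceil>real m * c $ i - p $ i - real m * \<eta>\<rceil>..\<lfloor>real m * c $ i - p $ i + real m * \<eta>\<rfloor>}" for i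
  define B where "B = {x. \<forall>i. x $ i \<in> A i}"
  have A: "real m * \<eta> \<le> real (card (A i))" for i
    using card_int_interval_ge[of "real m * c $ i - p $ i - real m * \<eta>" "real m * c $ i - p $ i + real m * \<eta>"] m
    unfolding A_def by linarith
  have "(real m * \<eta>) ^ CARD('d) = (\<Prod>i\<in>(UNIV :: 'd set). real m * \<eta>)" by simp
  also have "\<dots> \<le> (\<Prod>i\<in>UNIV. real (card (A i)))"
    using A m by (intro prod_mono) auto
  also have "\<dots> = real (card B)"
    unfolding B_def by (subst card_vec_box(2)) (auto simp: A_def)
  also have "card B = card ((\<lambda>z. p + of_int_vec z) ` B)"
    by (intro card_image[symmetric] inj_onI) (auto simp: of_int_vec_def Finite_Cartesian_Product.vec_eq_iff)
  also have "\<dots> \<le> card (sample_points S P m)"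
  proof (rule card_mono[OF fin], rule image_subsetI)
    fix z assume z: "z \<in> B"
    define y where "y = (1 / real m) *\<^sub>R (p + of_int_vec z)"
    have "\<bar>y $ i - c $ i\<bar> \<le> \<eta>" for i
    proof -
      have "z $ i \<in> A i" using z by (auto simp: B_def)
      then have "\<bar>p $ i + of_int (z $ i) - real m * c $ i\<bar> \<le> real m * \<eta>"
        unfolding A_def atLeastAtMost_iff ceiling_le_iff le_floor_iff by linarith
      moreover have "p $ i + of_int (z $ i) - real m * c $ i = real m * (y $ i - c $ i)"
        using m0 by (simp add: y_def of_int_vec_def field_simps)
      ultimately show ?thesis using m0 by (simp add: abs_mult)
    qed
    then have "y \<in> P" by (rule cube)
    moreover have "p + of_int_vec z = real m *\<^sub>R y" using m0 by (simp add: y_def)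
    ultimately show "p + of_int_vec z \<in> sample_points S P m"
      unfolding sample_points_def using p by blast
  qed
  finally show ?thesis by simp
qed

section \<open>The main theorem\<close>

lemma connected_mgraph_labels_nonempty:
  assumes "connected_mgraph G" "2 \<le> card (verts G)"
  shows "labels G \<noteq> {}"
proof -
  obtain u where u: "u \<in> verts G" using assms(1) by (auto simp: connected_mgraph_def)
  have "verts G \<noteq> {u}" using assms(2) by auto
  then obtain v where v: "v \<in> verts G" "u \<noteq> v" using u by blast
  then have "(u, v) \<in> {(x, nbr G x e) | x e. x \<in> verts G \<and> e \<in> labels G}\<^sup>*"
    using assms(1) u unfolding connected_mgraph_def by blast
  then show ?thesis using v(2) by (cases rule: converse_rtranclE) auto
qed

theorem mainTheorem1:
  fixes s :: "nat \<Rightarrow> real ^ 'd" and n\<^sub>S :: nat and S :: "(real ^ 'd) set"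
    and a :: "nat \<Rightarrow> real ^ 'd" and b b' :: "nat \<Rightarrow> real" and r :: nat
    and P Q :: "(real ^ 'd) set"
    and H :: "((int ^ 'd), nat) mgraph" and d\<^sub>H n\<^sub>H :: nat
    and rot :: "nat \<Rightarrow> (nat \<times> (int ^ 'd)) \<times> (int ^ 'd) \<Rightarrow> (nat \<times> (int ^ 'd)) \<times> (int ^ 'd)"
    and E :: "nat \<Rightarrow> (nat \<times> (int ^ 'd), (int ^ 'd)) mgraph"
    and G :: "nat \<Rightarrow> ((nat \<times> (int ^ 'd)) \<times> (int ^ 'd), nat \<times> nat) mgraph"
    and \<delta> :: "nat \<Rightarrow> real"
  assumes "n\<^sub>S \<ge> 1" and "inj_on s {..<n\<^sub>S}" and "S = s ` {..<n\<^sub>S}"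
    and "\<forall>p\<in>S. rational_vec p \<and> (\<forall>i. 0 \<le> p $ i \<and> p $ i < 1)"
    and "P = polyhedron_of r a b"
    and "\<forall>i<r. a i \<noteq> 0 \<and> rational_vec (a i) \<and> b i \<in> \<rat>"
    and "polytope P" and "aff_dim P = int CARD('d)"
    and "Q = polyhedron_of r a b'"
    and "\<forall>i<r. b' i \<in> \<rat> \<and> b' i \<ge> b i + sqrt (real CARD('d) / 2) * norm (a i)"
    and "regular_mgraph H" and "connected_mgraph H"
    and "verts H = {z. of_int_vec z + (\<chi> i. 1 / 2) \<in> Q}"
    and "labels H = {1..d\<^sub>H}"
    and "n\<^sub>H = card (verts H)"
    and "\<forall>m\<ge>1. rotation_map (E_verts n\<^sub>S m) (verts H) (rot m)"
    and "\<forall>m. E m = rotation_graph (E_verts n\<^sub>S m) (verts H) (rot m)"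
    and "\<forall>m. G m = zigzag (E_verts n\<^sub>S m) (rot m) H"
    and "second_eigenvalue H + 2 * real n\<^sub>H powr (- 1 / 2) < 0.99"
    and "\<forall>m\<ge>1. second_eigenvalue (E m) \<le> 2 * real n\<^sub>H powr (- 1 / 2) + \<delta> m"
    and "\<delta> \<longlonglongrightarrow> 0"
  shows "(\<exists>c<1. \<forall>\<^sub>F m in sequentially. second_eigenvalue (G m) \<le> c) \<and>
    rapidly_mixing G (\<lambda>m. walk (G m)) (\<lambda>m. pmf_of_set (verts (G m))) \<and>
    rapidly_mixing G (\<lambda>m. retained_law (G m) (vertex_point s m) (sample_points S P m))
      (\<lambda>m. pmf_of_set (sample_points S P m))"
proof -
  define h where "h = second_eigenvalue H"
  \<comment> \<open>The gap between 0.99 and 0.995 absorbs \<open>\<delta> m\<close> once it is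
    below 0.005, so that \<open>e\<close> bounds the second eigenvalue of \<open>E m\<close>; still
    \<open>e + h < 1\<close>, which forces \<open>c < 1\<close>.\<close>
  define e where "e = 0.995 - h"
  define c where "c = sqrt (h\<^sup>2 + (1 - h\<^sup>2) * (e\<^sup>2 + h\<^sup>2))"
  have finH: "finite (verts H)" and neH: "verts H \<noteq> {}"
    using assms by (auto simp: regular_mgraph_def connected_mgraph_def)
  have h0: "0 \<le> h" unfolding h_def by (rule second_eigenvalue_nonneg)
  have h: "h + 2 * real n\<^sub>H powr (- 1 / 2) < 0.99" using assms by (simp add: h_def)
  then have h1: "h < 0.99" using powr_ge_zero[of "real n\<^sub>H" "- 1 / 2"] by linarith
  have "n\<^sub>H \<noteq> 0" using finH neH assms by auto
  \<comment> \<open>For one vertex the term \<open>2 * real n\<^sub>H powr (- 1 / 2)\<close> would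
    be 2.\<close>
  moreover have "n\<^sub>H \<noteq> 1" using h h0 by auto
  ultimately have nH: "2 \<le> n\<^sub>H" by linarith
  have regH: "regular_graph H"
    using assms nH neH connected_mgraph_labels_nonempty[of H] by unfold_locales auto
  have contrH: "contracts H h"
    unfolding h_def using h1 by (intro regular_graph.contracts_second_eigenvalue regH) (simp add: h_def)
  have e: "0 < e" "e < 1" using h0 h1 by (auto simp: e_def)
  have h2: "h\<^sup>2 < 1" using h0 h1 by (simp add: power_less_one_iff)
  have "e\<^sup>2 + h\<^sup>2 \<le> (e + h)\<^sup>2" using h0 e by (simp add: power2_sum)
  also have "\<dots> < 1" by (simp add: e_def power2_eq_square)
  finally have eh: "e\<^sup>2 + h\<^sup>2 < 1" .
  have "(1 - h\<^sup>2) * (e\<^sup>2 + h\<^sup>2) < (1 - h\<^sup>2) * 1"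
    using h2 eh by (intro mult_strict_left_mono) auto
  then have c1: "c < 1" unfolding c_def by simp
  have "0 < (1 - h\<^sup>2) * (e\<^sup>2 + h\<^sup>2)" using h2 e by (intro mult_pos_pos add_pos_nonneg) auto
  then have c0: "0 < c" unfolding c_def by (simp add: add_nonneg_pos)
  have s01: "0 \<le> s k $ i \<and> s k $ i < 1" if "k < n\<^sub>S" for k i
    using that assms(3,4) by auto
  have zig: "regular_graph (G m) \<and> contracts (G m) c" if m: "1 \<le> m" "\<delta> m < 0.005" for m
  proof -
    have "card (E_verts n\<^sub>S m :: (nat \<times> (int ^ 'd)) set) \<noteq> 0"
      using assms(1) m by (simp add: card_E_verts)
    then have "(E_verts n\<^sub>S m :: (nat \<times> (int ^ 'd)) set) \<noteq> {}" by auto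
    then interpret zigzag_product H "E_verts n\<^sub>S m" "rot m"
      using assms(16) m regH E_verts_finite unfolding zigzag_product_def zigzag_product_axioms_def by auto
    have Em: "E m = rotation_graph (E_verts n\<^sub>S m) (verts H) (rot m)" using assms(17) by blast
    have "second_eigenvalue (E m) \<le> 2 * real n\<^sub>H powr (- 1 / 2) + \<delta> m" using assms(20) m by blast
    then have le: "second_eigenvalue (E m) \<le> e" using h m by (simp add: e_def)
    then have "contracts (E m) (second_eigenvalue (E m))"
      using E_regular e unfolding Em by (intro regular_graph.contracts_second_eigenvalue) auto
    then have "contracts (E m) e"
      using le by (rule contracts_mono[OF _ second_eigenvalue_nonneg])
    then have "contracts Z c"
      unfolding c_def Em using contrH e h0 h1 by (intro zigzag_contracts) auto
    then show ?thesis using Z_regular assms(18) by simp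
  qed
  have "\<forall>\<^sub>F m in sequentially. \<delta> m < 0.005"
    using assms(21) by (rule order_tendstoD) simp
  then have ev: "\<forall>\<^sub>F m in sequentially. regular_graph (G m) \<and> contracts (G m) c"
    using eventually_ge_at_top[of 1] by eventually_elim (rule zig)
  have "\<forall>\<^sub>F m in sequentially. second_eigenvalue (G m) \<le> c"
    using ev by eventually_elim (use c0 in \<open>auto intro: regular_graph.second_eigenvalue_le\<close>)
  moreover have "rapidly_mixing G (\<lambda>m. walk (G m)) (\<lambda>m. pmf_of_set (verts (G m)))"
    by (rule rapidly_mixing_walk[OF c0 c1 ev])
  moreover have "rapidly_mixing G (\<lambda>m. retained_law (G m) (vertex_point s m) (sample_points S P m))
      (\<lambda>m. pmf_of_set (sample_points S P m))"
  proof -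
    obtain x\<^sub>0 \<eta> where \<eta>: "0 < \<eta>" and cube: "\<And>y. (\<And>i. \<bar>y $ i - x\<^sub>0 $ i\<bar> \<le> \<eta>) \<Longrightarrow> y \<in> P"
      using full_dim_polytope_contains_cube[OF assms(7,8)] by blast
    \<comment> \<open>The lower bound for the number of sample points divided by the number of
      vertices, from which the powers of \<open>m\<close> cancel.\<close>
    define \<rho> where "\<rho> = \<eta> ^ CARD('d) / (real n\<^sub>S * real n\<^sub>H)"
    have \<rho>: "0 < \<rho>" using \<eta> assms(1) nH by (simp add: \<rho>_def)
    have "\<forall>\<^sub>F m in sequentially. 1 / \<eta> \<le> real m"
      using filterlim_real_sequentially by (simp add: filterlim_at_top)
    then have "\<forall>\<^sub>F m in sequentially. inj_on (vertex_point s m) (verts (G m)) \<and>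
      sample_points S P m \<subseteq> vertex_point s m ` verts (G m) \<and> sample_points S P m \<noteq> {} \<and>
      2 \<le> card (verts (G m)) \<and> \<rho> * real (card (verts (G m))) \<le> real (card (sample_points S P m))"
      using eventually_ge_at_top[of 1]
    proof eventually_elim
      case (elim m)
      have vG: "verts (G m) = E_verts n\<^sub>S m \<times> verts H" using assms(18) by (simp add: zigzag_def)
      then have cG: "card (verts (G m)) = n\<^sub>S * m ^ CARD('d) * n\<^sub>H"
        using assms(15) by (simp add: card_cartesian_product card_E_verts)
      have finG: "finite (verts (G m))" unfolding vG using finH E_verts_finite by blast
      have inj: "inj_on (vertex_point s m) (verts (G m))"
        unfolding vG by (rule inj_on_vertex_point) (use elim assms(2) s01 in auto)
      have cover: "sample_points S P m \<subseteq> vertex_point s m ` verts (G m)"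
        unfolding vG assms(3,5,9,13) by (rule sample_points_covered) (use elim assms(10) s01 in auto)
      have m\<eta>: "1 \<le> real m * \<eta>" using elim \<eta> by (simp add: field_simps)
      have "s 0 \<in> S" using assms(1,3) by auto
      then have ge: "(real m * \<eta>) ^ CARD('d) \<le> real (card (sample_points S P m))"
        using finite_subset[OF cover finite_imageI[OF finG]] by (intro card_sample_points_ge[OF cube \<eta> m\<eta>])
      have "0 < (real m * \<eta>) ^ CARD('d)" using m\<eta> by (intro zero_less_power) linarith
      then have "sample_points S P m \<noteq> {}" using ge by auto
      moreover have "2 \<le> card (verts (G m))"
      proof -
        have "1 * 2 \<le> n\<^sub>S * m ^ CARD('d) * n\<^sub>H"
          using assms(1) nH elim by (intro mult_le_mono) auto
        then show ?thesis by (simp add: cG)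
      qed
      moreover have "\<rho> * real (card (verts (G m))) = (real m * \<eta>) ^ CARD('d)"
        using assms(1) nH by (simp add: \<rho>_def cG power_mult_distrib)
      ultimately show ?case using inj cover ge by simp
    qed
    then show ?thesis by (rule rapidly_mixing_retained[OF c0 c1 \<rho> ev])
  qed
  ultimately show ?thesis using c1 by blast
qed

end
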